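(* (Boltzmann-Gibbs Principle) Fix $0<\gamma<1/3$. For every $t>0$ and $H\in S(\mathbb{R})$, $$\lim_{N\rightarrow\infty}\mathbb{E}_{\nu_{\alpha}}^{\gamma}\left[\left(\int_{0}^{t}\frac{N^{\gamma}}{\sqrt{N}}\sum_{x\in\mathbb{Z}}H\left(\frac{x}{N}\right)\bar{\eta}^N_{s}(x)\,\bar{\eta}^N_{s}(x+1)\,ds\right)^{2}\right]=0.$$
   Context: Asymmetric simple exclusion process (ASEP): let $p\in[0,1]$, $p\neq 1/2$, $q=1-p$. $(\eta_t)_{t\ge0}$ is the Markov process on $\{0,1\}^{\mathbb{Z}}$ with generator given on local functions by $Lf(\eta)=\sum_{x\in\mathbb{Z}}\sum_{y=x\pm1}p(x,y)\eta(x)(1-\eta(y))[f(\eta^{x,y})-f(\eta)]$, where $p(x,x+1)=p$, $p(x,x-1)=q$ and $\eta^{x,y}$ is $\eta$ with the values at $x$ and $y$ exchanged. Fix $\alpha\in(0,1)$; $\nu_\alpha$ is the Bernoulli product measure on $\{0,1\}^{\mathbb{Z}}$ of parameter $\alpha$. $\eta^N_s=\eta_{sN^{1+\gamma}}$ is the process speeded up by $N^{1+\gamma}$ and $\mathbb{E}^\gamma_{\nu_\alpha}$ is expectation for this process started from $\nu_\alpha$. The bar denotes centering: $\bar\eta(x)=\eta(x)-\alpha$. $S(\mathbb{R})$ is the space of smooth rapidly decreasing functions on $\mathbb{R}$. *)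

theory Defs
  imports "HOL-Probability.Probability"
begin

section \<open>Configurations and the exclusion generator\<close>

text \<open>
  A configuration in \<open>{0,1}\<^sup>\<int>\<close> is a map from \<open>int\<close> to \<open>bool\<close>; \<open>True\<close> means that the site is
  occupied. The library topology on this function type is the product topology, for which the
  space is compact, so \<open>config \<Rightarrow>\<^sub>C real\<close> is the Banach space of all continuous functions with the
  supremum norm.
\<close>

type_synonym config = "int \<Rightarrow> bool"

definition config_space :: "config measure" where
  "config_space = (\<Pi>\<^sub>M x\<in>UNIV. count_space UNIV)"

definition bernoulli_measure :: "real \<Rightarrow> config measure" where
  "bernoulli_measure \<alpha> = (\<Pi>\<^sub>M x\<in>UNIV. measure_pmf (bernoulli_pmf \<alpha>))"

definition exchange :: "config \<Rightarrow> int \<Rightarrow> int \<Rightarrow> config" where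
  "exchange \<eta> x y = \<eta>(x := \<eta> y, y := \<eta> x)"

definition jump_rate :: "real \<Rightarrow> int \<Rightarrow> int \<Rightarrow> real" where
  "jump_rate p x y = (if y = x + 1 then p else if y = x - 1 then 1 - p else 0)"

definition local_function :: "(config \<Rightarrow> real) \<Rightarrow> bool" where
  "local_function f \<longleftrightarrow>
     (\<exists>A. finite A \<and> (\<forall>\<eta> \<zeta>. (\<forall>x\<in>A. \<eta> x = \<zeta> x) \<longrightarrow> f \<eta> = f \<zeta>))"

text \<open>For local \<open>f\<close> only finitely many terms of the sum over \<open>x\<close> are nonzero.\<close>

definition exclusion_generator :: "real \<Rightarrow> (config \<Rightarrow> real) \<Rightarrow> config \<Rightarrow> real" where
  "exclusion_generator p f \<eta> =
     (\<Sum>\<^sub>\<infinity>x\<in>UNIV. \<Sum>y\<in>{x - 1, x + 1}.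
        jump_rate p x y * of_bool (\<eta> x) * (1 - of_bool (\<eta> y)) * (f (exchange \<eta> x y) - f \<eta>))"

section \<open>Markov semigroups and their generators\<close>

definition markov_semigroup ::
  "(real \<Rightarrow> ('a::topological_space \<Rightarrow>\<^sub>C real) \<Rightarrow> ('a \<Rightarrow>\<^sub>C real)) \<Rightarrow> bool" where
  "markov_semigroup S \<longleftrightarrow>
     (\<forall>t\<ge>0. linear (S t)) \<and>
     (\<forall>f. S 0 f = f) \<and>
     (\<forall>s\<ge>0. \<forall>t\<ge>0. \<forall>f. S (s + t) f = S s (S t f)) \<and>
     (\<forall>t\<ge>0. S t (const_bcontfun 1) = const_bcontfun 1) \<and>
     (\<forall>t\<ge>0. \<forall>f. (\<forall>x. 0 \<le> apply_bcontfun f x) \<longrightarrow> (\<forall>x. 0 \<le> apply_bcontfun (S t f) x)) \<and>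
     (\<forall>f. ((\<lambda>t. S t f) \<longlongrightarrow> f) (at_right 0))"

definition generator_graph ::
  "(real \<Rightarrow> ('a::topological_space \<Rightarrow>\<^sub>C real) \<Rightarrow> ('a \<Rightarrow>\<^sub>C real))
     \<Rightarrow> (('a \<Rightarrow>\<^sub>C real) \<times> ('a \<Rightarrow>\<^sub>C real)) set" where
  "generator_graph S = {(f, g). ((\<lambda>t. (S t f - f) /\<^sub>R t) \<longlongrightarrow> g) (at_right 0)}"

text \<open>
  As usual for interacting particle systems, the process whose generator is given on local
  functions by \<open>L\<close> is the one whose generator is the closure of \<open>L\<close> on local functions. Every local
  function is continuous, and so is its image under \<open>L\<close>, which is local again; hence each local
  function does occur in the graph below.
\<close>

definition asep_semigroup ::
  "real \<Rightarrow> (real \<Rightarrow> (config \<Rightarrow>\<^sub>C real) \<Rightarrow> (config \<Rightarrow>\<^sub>C real)) \<Rightarrow> bool" where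
  "asep_semigroup p S \<longleftrightarrow>
     markov_semigroup S \<and>
     generator_graph S =
       closure {(f, g). local_function (apply_bcontfun f) \<and>
                        apply_bcontfun g = exclusion_generator p (apply_bcontfun f)}"

section \<open>The process\<close>

definition natural_filtration ::
  "'w measure \<Rightarrow> (real \<Rightarrow> 'w \<Rightarrow> config) \<Rightarrow> real \<Rightarrow> 'w measure" where
  "natural_filtration M X s =
     sigma (space M) {X u -` A \<inter> space M | u A. 0 \<le> u \<and> u \<le> s \<and> A \<in> sets config_space}"

definition cadlag :: "(real \<Rightarrow> 'a::topological_space) \<Rightarrow> bool" where
  "cadlag w \<longleftrightarrow>
     (\<forall>t\<ge>0. (w \<longlongrightarrow> w t) (at_right t)) \<and> (\<forall>t>0. \<exists>l. (w \<longlongrightarrow> l) (at_left t))"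

text \<open>
  A realisation on the probability space \<open>M\<close> of the process started from \<open>\<mu>\<close>. Only times \<open>t \<ge> 0\<close>
  are constrained.
\<close>

definition asep_process ::
  "real \<Rightarrow> config measure \<Rightarrow> 'w measure \<Rightarrow> (real \<Rightarrow> 'w \<Rightarrow> config) \<Rightarrow> bool" where
  "asep_process p \<mu> M X \<longleftrightarrow>
     prob_space M \<and>
     (\<forall>t\<ge>0. X t \<in> measurable M config_space) \<and>
     (\<forall>\<omega>\<in>space M. cadlag (\<lambda>t. X t \<omega>)) \<and>
     distr M config_space (X 0) = \<mu> \<and>
     (\<exists>S. asep_semigroup p S \<and>
        (\<forall>s\<ge>0. \<forall>t\<ge>0. \<forall>f.
           AE \<omega> in M. real_cond_exp M (natural_filtration M X s) (\<lambda>\<omega>. apply_bcontfun f (X (s + t) \<omega>)) \<omega>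
             = apply_bcontfun (S t f) (X s \<omega>)))"

definition speeded_up :: "real \<Rightarrow> nat \<Rightarrow> (real \<Rightarrow> 'w \<Rightarrow> config) \<Rightarrow> real \<Rightarrow> 'w \<Rightarrow> config" where
  "speeded_up \<gamma> N X s = X (s * real N powr (1 + \<gamma>))"

definition centered :: "real \<Rightarrow> config \<Rightarrow> int \<Rightarrow> real" where
  "centered \<alpha> \<eta> x = of_bool (\<eta> x) - \<alpha>"

section \<open>Test functions\<close>

definition schwartz :: "(real \<Rightarrow> real) \<Rightarrow> bool" where
  "schwartz H \<longleftrightarrow>
     (\<forall>n x. (deriv ^^ n) H field_differentiable at x) \<and>
     (\<forall>m n. bounded (range (\<lambda>x. x ^ m * (deriv ^^ n) H x)))"

end

theory Submission
  imports Defs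
begin

text \<open>
  Write \<open>c\<^sub>x\<close> for the centred occupation variable of the site \<open>x\<close> and \<open>\<langle>f, g\<rangle>\<close> for the inner product of
  \<open>L\<^sup>2(\<nu>\<^sub>\<alpha>)\<close>. With \<open>h(x) = H(x/N)\<close> the theorem is about the time integral of the quadratic field
  \<open>V = \<Sum>\<^sub>x h(x) c\<^sub>x c\<^bsub>x+1\<^esub>\<close>. Fix a block length \<open>K\<close> and replace the neighbour \<open>c\<^bsub>x+1\<^esub>\<close> by the average of
  \<open>c\<^bsub>x+1\<^esub>, \<dots>, c\<^bsub>x+K\<^esub>\<close>. This writes \<open>V\<close> as \<open>W + R\<close>, where \<open>R\<close> (\<open>block_average\<close>) is the field with the average
  and \<open>W\<close> (\<open>block_gradient\<close>) is the error of the replacement.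

  \<open>R\<close> is small because products \<open>c\<^sub>x c\<^sub>y\<close> over different pairs of sites are orthogonal in \<open>L\<^sup>2(\<nu>\<^sub>\<alpha>)\<close>: its
  second moment is at most \<open>K\<^sup>-\<^sup>1 \<Sum> h\<^sup>2\<close>, and by stationarity the second moment of its integral over
  \<open>[0,T]\<close> is at most \<open>T\<^sup>2\<close> times that.

  \<open>W\<close> is a sum of gradients \<open>\<Sum>\<^sub>y F\<^sub>y (c\<^sub>y - c\<^bsub>y+1\<^esub>)\<close>, and \<open>F\<^sub>y\<close> involves only sites to the left of \<open>y\<close>, so that it
  does not change when the values at \<open>y\<close> and \<open>y+1\<close> are exchanged. Since \<open>\<nu>\<^sub>\<alpha>\<close> is exchangeable, the
  pairing of the \<open>y\<close>-th term with a function \<open>f\<close> only sees the change of \<open>f\<close> under this exchange, and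
  the sum of the squares of these changes is four times the Dirichlet form \<open>- \<langle>f, L f\<rangle>\<close>. Together with
  \<open>\<Sum>\<^sub>y \<langle>F\<^sub>y, F\<^sub>y\<rangle> \<le> K \<Sum> h\<^sup>2\<close> this gives \<open>2 \<langle>W, f\<rangle> \<le> B - \<langle>f, L f\<rangle>\<close> with \<open>B = K \<Sum> h\<^sup>2\<close>, first for
  local \<open>f\<close> (\<open>block_gradient_dirichlet_bound\<close>) and then on the whole graph of the generator, because
  both sides are continuous (\<open>generator_graph_block_gradient_bound\<close>).

  Such a bound controls time integrals (\<open>semigroup_energy_estimate\<close>). Let \<open>U\<^sub>s\<close> be the integral of \<open>S\<^sub>r W\<close> over
  \<open>0 \<le> r \<le> s\<close>. Then \<open>L U\<^sub>s = S\<^sub>s W - W\<close>, so the derivative of \<open>\<langle>U\<^sub>s, U\<^sub>s\<rangle>\<close> is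
  \<open>2 \<langle>W, U\<^sub>s\<rangle> + 2 \<langle>U\<^sub>s, L U\<^sub>s\<rangle> \<le> 2 B - 2 \<langle>W, U\<^sub>s\<rangle>\<close>. Integrating over \<open>[0,T]\<close> bounds twice the integral of
  \<open>\<langle>W, U\<^sub>s\<rangle>\<close> by \<open>2 B T\<close>, and twice that integral is exactly the second moment of the integral of \<open>W\<close>
  along the stationary process.

  For the process speeded up by \<open>N\<^bsup>1+\<gamma>\<^esup>\<close> one has \<open>T = t N\<^bsup>1+\<gamma>\<^esup>\<close>, and \<open>\<Sum> h\<^sup>2\<close> is of order \<open>N\<close>. After
  multiplication by the scaling factors the two contributions are of order \<open>K N\<^bsup>\<gamma>-1\<^esup>\<close> and \<open>N\<^bsup>2\<gamma>\<^esup> / K\<close>. They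
  balance for \<open>K = N\<^bsup>(1+\<gamma>)/2\<^esup>\<close>, where both are of order \<open>N\<^bsup>(3\<gamma>-1)/2\<^esup>\<close>; this tends to zero exactly when
  \<open>\<gamma> < 1/3\<close>.
\<close>

section \<open>Bounded continuous functions\<close>

text \<open>
  A uniform limit of continuous functions is continuous on every topological space, so completeness
  in the supremum norm asks nothing of the domain. It makes integrals of \<open>t \<mapsto> S t f\<close> over time
  intervals meaningful.
\<close>

instance bcontfun :: (topological_space, complete_space) complete_space
proof
  fix F :: "nat \<Rightarrow> ('a, 'b) bcontfun"
  assume "Cauchy F"
  have "uniformly_Cauchy_on UNIV (\<lambda>n. apply_bcontfun (F n))"
  proof (rule uniformly_Cauchy_onI)
    fix e :: real
    assume "0 < e"
    with \<open>Cauchy F\<close> obtain m where "\<forall>i\<ge>m. \<forall>j\<ge>m. dist (F i) (F j) < e"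
      unfolding Cauchy_def by blast
    then show "\<exists>m. \<forall>x\<in>UNIV. \<forall>i\<ge>m. \<forall>j\<ge>m. dist (apply_bcontfun (F i) x) (apply_bcontfun (F j) x) < e"
      using dist_fun_lt_imp_dist_val_lt by blast
  qed
  then obtain g where "uniform_limit UNIV (\<lambda>n. apply_bcontfun (F n)) g sequentially"
    using Cauchy_uniformly_convergent unfolding uniformly_convergent_on_def by blast
  from uniform_limit_bcontfunE[OF this sequentially_bot]
  obtain G where "F \<longlonglongrightarrow> G" by metis
  then show "convergent F" by (rule convergentI)
qed

instance bcontfun :: (topological_space, banach) banach ..

lemma abs_mult_le: "\<bar>a\<bar> \<le> A \<Longrightarrow> \<bar>b\<bar> \<le> B \<Longrightarrow> \<bar>a * b\<bar> \<le> A * B" for a b :: real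
  unfolding abs_mult by (rule mult_mono) auto

lemma bcontfun_mult:
  fixes f g :: "'a::topological_space \<Rightarrow> real"
  assumes "f \<in> bcontfun" "g \<in> bcontfun"
  shows "(\<lambda>x. f x * g x) \<in> bcontfun"
proof -
  obtain C D where "\<And>x. \<bar>f x\<bar> \<le> C" "\<And>x. \<bar>g x\<bar> \<le> D"
    using assms unfolding bcontfun_def bounded_iff by auto
  then have "norm (f x * g x) \<le> C * D" for x using abs_mult_le by simp
  then show ?thesis
    using assms by (intro bcontfun_normI[where b = "C * D"]) (auto simp: bcontfun_def intro!: continuous_intros)
qed

lemma bcontfun_sum:
  fixes f :: "'i \<Rightarrow> 'a::topological_space \<Rightarrow> real"
  assumes "\<And>i. i \<in> I \<Longrightarrow> f i \<in> bcontfun"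
  shows "(\<lambda>x. \<Sum>i\<in>I. f i x) \<in> bcontfun"
  using assms by (induction I rule: infinite_finite_induct) (auto intro: const_bcontfun plus_cont)

lemma apply_bcontfun_measurable:
  assumes "sets \<mu> = sets borel"
  shows "apply_bcontfun (f :: 'a::topological_space \<Rightarrow>\<^sub>C real) \<in> borel_measurable \<mu>"
  using borel_measurable_continuous_onI[of "apply_bcontfun f"] assms
  by (simp cong: measurable_cong_sets)

lemma apply_bcontfun_abs_le: "\<bar>apply_bcontfun (f :: 'a::topological_space \<Rightarrow>\<^sub>C real) x\<bar> \<le> norm f"
  using norm_bounded[of f x] by simp

lemma apply_bcontfun_mult_abs_le:
  "\<bar>apply_bcontfun (f :: 'a::topological_space \<Rightarrow>\<^sub>C real) x * apply_bcontfun g y\<bar> \<le> norm f * norm g"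
  unfolding abs_mult by (intro mult_mono apply_bcontfun_abs_le) auto

definition bcontfun_inner ::
  "'a measure \<Rightarrow> ('a::topological_space \<Rightarrow>\<^sub>C real) \<Rightarrow> ('a \<Rightarrow>\<^sub>C real) \<Rightarrow> real"
  where "bcontfun_inner \<mu> f g = (\<integral>x. apply_bcontfun f x * apply_bcontfun g x \<partial>\<mu>)"

lemma bcontfun_integrable:
  assumes "prob_space \<mu>" "sets \<mu> = sets borel"
  shows "integrable \<mu> (apply_bcontfun (f :: 'a::topological_space \<Rightarrow>\<^sub>C real))"
proof -
  interpret prob_space \<mu> by fact
  show ?thesis
    using apply_bcontfun_abs_le[of f] apply_bcontfun_measurable[OF assms(2)]
    by (intro integrable_const_bound[where B = "norm f"]) auto
qed

lemma bcontfun_mult_integrable: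
  assumes "prob_space \<mu>" "sets \<mu> = sets borel"
  shows "integrable \<mu> (\<lambda>x. apply_bcontfun (f :: 'a::topological_space \<Rightarrow>\<^sub>C real) x * apply_bcontfun g x)"
proof -
  interpret prob_space \<mu> by fact
  show ?thesis
    using apply_bcontfun_mult_abs_le[of f] apply_bcontfun_measurable[OF assms(2)]
    by (intro integrable_const_bound[where B = "norm f * norm g"]) auto
qed

lemma bounded_bilinear_bcontfun_inner:
  assumes "prob_space \<mu>" "sets \<mu> = sets borel"
  shows "bounded_bilinear (bcontfun_inner \<mu> :: ('a::topological_space \<Rightarrow>\<^sub>C real) \<Rightarrow> _)"
proof -
  interpret prob_space \<mu> by fact
  note int = bcontfun_mult_integrable[OF assms]
  have "\<bar>bcontfun_inner \<mu> f g\<bar> \<le> norm f * norm g" for f g :: "'a \<Rightarrow>\<^sub>C real"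
  proof -
    have "\<bar>bcontfun_inner \<mu> f g\<bar> \<le> (\<integral>x. norm f * norm g \<partial>\<mu>)"
      unfolding bcontfun_inner_def
      by (rule order_trans[OF integral_abs_bound integral_mono])
         (auto intro: integrable_abs int apply_bcontfun_mult_abs_le)
    then show ?thesis by (simp add: prob_space)
  qed
  then show ?thesis
    by unfold_locales
      (auto simp: bcontfun_inner_def distrib_left distrib_right int mult.assoc mult.left_commute
        intro!: exI[of _ 1])
qed

section \<open>Markov semigroups\<close>

lemma markov_semigroup_linear: "markov_semigroup S \<Longrightarrow> 0 \<le> t \<Longrightarrow> linear (S t)"
  by (simp add: markov_semigroup_def)

lemma markov_semigroup_zero: "markov_semigroup S \<Longrightarrow> S 0 f = f"
  by (simp add: markov_semigroup_def)

lemma markov_semigroup_add: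
  "markov_semigroup S \<Longrightarrow> 0 \<le> s \<Longrightarrow> 0 \<le> t \<Longrightarrow> S (s + t) f = S s (S t f)"
  by (simp add: markov_semigroup_def)

lemma markov_semigroup_le:
  fixes S :: "real \<Rightarrow> ('a::topological_space \<Rightarrow>\<^sub>C real) \<Rightarrow> ('a \<Rightarrow>\<^sub>C real)"
  assumes S: "markov_semigroup S" and "0 \<le> t" and le: "\<And>x. apply_bcontfun f x \<le> c"
  shows "apply_bcontfun (S t f) x \<le> c"
proof -
  have eq: "S t (c *\<^sub>R const_bcontfun 1 - f) = c *\<^sub>R const_bcontfun 1 - S t f"
    using linear_diff[OF markov_semigroup_linear[OF S \<open>0 \<le> t\<close>]]
      linear_cmul[OF markov_semigroup_linear[OF S \<open>0 \<le> t\<close>]] S \<open>0 \<le> t\<close>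
    by (simp add: markov_semigroup_def)
  have "\<forall>x. 0 \<le> apply_bcontfun (c *\<^sub>R const_bcontfun 1 - f) x"
    using le by simp
  then have "\<forall>x. 0 \<le> apply_bcontfun (S t (c *\<^sub>R const_bcontfun 1 - f)) x"
    using S \<open>0 \<le> t\<close> unfolding markov_semigroup_def by blast
  then show ?thesis by (simp add: eq)
qed

lemma markov_semigroup_norm_le:
  fixes S :: "real \<Rightarrow> ('a::topological_space \<Rightarrow>\<^sub>C real) \<Rightarrow> ('a \<Rightarrow>\<^sub>C real)"
  assumes S: "markov_semigroup S" and t: "0 \<le> t"
  shows "norm (S t f) \<le> norm f"
proof (rule norm_bound)
  fix x
  have b: "\<bar>apply_bcontfun f y\<bar> \<le> norm f" for y using norm_bounded[of f y] by simp
  have "apply_bcontfun (S t f) x \<le> norm f"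
    by (rule markov_semigroup_le[OF S t]) (use b abs_le_iff in blast)
  moreover have "apply_bcontfun (S t (- f)) x \<le> norm f"
  proof (rule markov_semigroup_le[OF S t])
    fix y show "apply_bcontfun (- f) y \<le> norm f" using b[of y] by simp
  qed
  ultimately show "norm (apply_bcontfun (S t f) x) \<le> norm f"
    using linear_neg[OF markov_semigroup_linear[OF S t], of f] by (simp add: abs_le_iff)
qed

lemma markov_semigroup_bounded_linear:
  fixes S :: "real \<Rightarrow> ('a::topological_space \<Rightarrow>\<^sub>C real) \<Rightarrow> ('a \<Rightarrow>\<^sub>C real)"
  assumes "markov_semigroup S" "0 \<le> t"
  shows "bounded_linear (S t)"
  using markov_semigroup_linear[OF assms] markov_semigroup_norm_le[OF assms]
  by (intro bounded_linear.intro bounded_linear_axioms.intro exI[of _ 1]) auto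

lemma markov_semigroup_diff_le:
  fixes S :: "real \<Rightarrow> ('a::topological_space \<Rightarrow>\<^sub>C real) \<Rightarrow> ('a \<Rightarrow>\<^sub>C real)"
  assumes S: "markov_semigroup S" and "0 \<le> s" "0 \<le> t"
  shows "norm (S t f - S s f) \<le> norm (S \<bar>t - s\<bar> f - f)"
proof -
  have *: "norm (S (a + h) f - S a f) \<le> norm (S h f - f)" if "0 \<le> a" "0 \<le> h" for a h
    using markov_semigroup_norm_le[OF S \<open>0 \<le> a\<close>, of "S h f - f"] markov_semigroup_add[OF S that]
      linear_diff[OF markov_semigroup_linear[OF S \<open>0 \<le> a\<close>]] by simp
  show ?thesis
  proof (cases "s \<le> t")
    case True
    then show ?thesis using *[of s "t - s"] \<open>0 \<le> s\<close> by simp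
  next
    case False
    then show ?thesis using *[of t "s - t"] \<open>0 \<le> t\<close> by (simp add: norm_minus_commute)
  qed
qed

text \<open>
  Strong continuity at \<open>0\<close> spreads to all times in both directions: by contractivity the distance of
  \<open>S t f\<close> and \<open>S s f\<close> is at most that of \<open>S \<bar>t - s\<bar> f\<close> and \<open>f\<close>.
\<close>

lemma markov_semigroup_continuous_on:
  fixes S :: "real \<Rightarrow> ('a::topological_space \<Rightarrow>\<^sub>C real) \<Rightarrow> ('a \<Rightarrow>\<^sub>C real)"
  assumes S: "markov_semigroup S"
  shows "continuous_on {0..} (\<lambda>t. S t f)"
proof -
  have "((\<lambda>t. S t f) \<longlongrightarrow> f) (at_right 0)" using S by (simp add: markov_semigroup_def)
  then have lim: "((\<lambda>t. norm (S t f - f)) \<longlongrightarrow> 0) (at_right 0)"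
    by (simp add: LIM_zero tendsto_norm_zero)
  show ?thesis
    unfolding continuous_on_iff
  proof (intro ballI allI impI)
    fix s e :: real assume s: "s \<in> {0..}" and e: "0 < e"
    have "\<forall>\<^sub>F t in at_right 0. norm (S t f - f) < e"
      using order_tendstoD(2)[OF lim e] .
    then obtain d where d: "0 < d" "\<And>t. 0 < t \<Longrightarrow> t < d \<Longrightarrow> norm (S t f - f) < e"
      unfolding eventually_at_right_field by auto
    have "dist (S t f) (S s f) < e" if "t \<in> {0..}" "dist t s < d" for t
    proof (cases "t = s")
      case False
      then have "norm (S \<bar>t - s\<bar> f - f) < e" using d(2)[of "\<bar>t - s\<bar>"] that by (simp add: dist_real_def)
      then show ?thesis using markov_semigroup_diff_le[OF S, of s t f] that s by (simp add: dist_norm)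
    qed (use e in simp)
    then show "\<exists>d>0. \<forall>x'\<in>{0..}. dist x' s < d \<longrightarrow> dist (S x' f) (S s f) < e"
      using d(1) by blast
  qed
qed

definition semigroup_integral ::
  "(real \<Rightarrow> ('a::topological_space \<Rightarrow>\<^sub>C real) \<Rightarrow> ('a \<Rightarrow>\<^sub>C real)) \<Rightarrow> ('a \<Rightarrow>\<^sub>C real) \<Rightarrow> real \<Rightarrow> ('a \<Rightarrow>\<^sub>C real)"
  where "semigroup_integral S f s = integral {0..s} (\<lambda>r. S r f)"

lemma markov_semigroup_integrable:
  fixes S :: "real \<Rightarrow> ('a::topological_space \<Rightarrow>\<^sub>C real) \<Rightarrow> ('a \<Rightarrow>\<^sub>C real)"
  assumes "markov_semigroup S" "0 \<le> a"
  shows "(\<lambda>r. S r f) integrable_on {a..b}"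
  by (intro integrable_continuous_real continuous_on_subset[OF markov_semigroup_continuous_on[OF assms(1)]])
     (use assms in auto)

lemma semigroup_integral_has_derivative:
  fixes S :: "real \<Rightarrow> ('a::topological_space \<Rightarrow>\<^sub>C real) \<Rightarrow> ('a \<Rightarrow>\<^sub>C real)"
  assumes S: "markov_semigroup S" and "s \<in> {0..T}"
  shows "(semigroup_integral S f has_vector_derivative S s f) (at s within {0..T})"
  unfolding semigroup_integral_def
  by (rule integral_has_vector_derivative
      [OF continuous_on_subset[OF markov_semigroup_continuous_on[OF S]] assms(2)]) auto

lemma semigroup_integral_right_quotient:
  fixes S :: "real \<Rightarrow> ('a::topological_space \<Rightarrow>\<^sub>C real) \<Rightarrow> ('a \<Rightarrow>\<^sub>C real)"
  assumes S: "markov_semigroup S" and "0 \<le> s"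
  shows "((\<lambda>h. (semigroup_integral S f (s + h) - semigroup_integral S f s) /\<^sub>R h) \<longlongrightarrow> S s f)
    (at_right 0)"
proof -
  let ?F = "semigroup_integral S f"
  have "(?F has_vector_derivative S s f) (at s within {0..s+1})"
    using assms by (intro semigroup_integral_has_derivative) auto
  then have "((\<lambda>y. (1 / norm (y - s)) *\<^sub>R (?F y - (?F s + (y - s) *\<^sub>R S s f))) \<longlongrightarrow> 0)
     (at s within {0..s+1})"
    by (simp add: has_vector_derivative_def has_derivative_within)
  moreover have "filterlim (\<lambda>h. s + h) (at s within {0..s+1}) (at_right 0)"
    unfolding filterlim_at
  proof (intro conjI)
    show "\<forall>\<^sub>F h in at_right 0. s + h \<in> {0..s + 1} \<and> s + h \<noteq> s"
      using assms by (intro eventually_at_rightI[of 0 1]) auto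
    show "((\<lambda>h. s + h) \<longlongrightarrow> s) (at_right 0)" by (rule tendsto_eq_intros refl | simp)+
  qed
  ultimately have "((\<lambda>h. (1 / norm (s + h - s)) *\<^sub>R (?F (s + h) - (?F s + (s + h - s) *\<^sub>R S s f))) \<longlongrightarrow> 0)
     (at_right 0)"
    by (rule filterlim_compose)
  then have "((\<lambda>h. (?F (s + h) - ?F s) /\<^sub>R h - S s f) \<longlongrightarrow> 0) (at_right 0)"
  proof (rule Lim_transform_eventually[OF _ eventually_at_rightI[of 0 1]])
    fix h :: real assume "h \<in> {0<..<1}"
    then show "(1 / norm (s + h - s)) *\<^sub>R (?F (s + h) - (?F s + (s + h - s) *\<^sub>R S s f))
      = (?F (s + h) - ?F s) /\<^sub>R h - S s f"
      by (simp add: scaleR_diff_right scaleR_add_right divide_inverse)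
  qed simp
  then show ?thesis by (rule LIM_zero_cancel)
qed

text \<open>
  Time integrals lie in the domain of the generator even when \<open>f\<close> does not: applying \<open>S h\<close> to the
  integral over \<open>[0,s]\<close> shifts the interval to \<open>[h,s+h]\<close>, so that only the two boundary pieces
  contribute to the difference quotient. In this way a bound on the graph of the generator can be used
  for an arbitrary continuous \<open>f\<close>.
\<close>

lemma semigroup_integral_in_generator_graph:
  fixes S :: "real \<Rightarrow> ('a::topological_space \<Rightarrow>\<^sub>C real) \<Rightarrow> ('a \<Rightarrow>\<^sub>C real)"
  assumes S: "markov_semigroup S" and s: "0 \<le> s"
  shows "(semigroup_integral S f s, S s f - f) \<in> generator_graph S"
proof -
  let ?F = "semigroup_integral S f"
  have shift: "S h (?F s) = ?F (s + h) - ?F h" if "0 < h" for h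
  proof -
    have "S h (?F s) = integral {0..s} (\<lambda>r. S h (S r f))"
      using integral_linear[OF markov_semigroup_integrable[OF S order_refl, of f s]
          markov_semigroup_bounded_linear[OF S, of h]] that
      by (simp add: semigroup_integral_def o_def)
    also have "\<dots> = integral {0..s} (\<lambda>r. S (r + h) f)"
      using that by (intro integral_cong) (simp add: markov_semigroup_add[OF S, symmetric] add.commute)
    also have "\<dots> = integral {h..s + h} (\<lambda>r. S r f)"
      using integral_shift_real_ivl[of h h "s + h" "\<lambda>r. S r f"] by simp
    also have "\<dots> = ?F (s + h) - ?F h"
      using Henstock_Kurzweil_Integration.integral_combine[of 0 h "s + h" "\<lambda>r. S r f"] that s
        markov_semigroup_integrable[OF S order_refl, of f "s + h"]
      by (simp add: semigroup_integral_def algebra_simps)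
    finally show ?thesis .
  qed
  have "((\<lambda>h. (?F (s + h) - ?F s) /\<^sub>R h - (?F (0 + h) - ?F 0) /\<^sub>R h) \<longlongrightarrow> S s f - S 0 f) (at_right 0)"
    by (intro tendsto_diff semigroup_integral_right_quotient S s) simp
  then have "((\<lambda>h. (S h (?F s) - ?F s) /\<^sub>R h) \<longlongrightarrow> S s f - f) (at_right 0)"
  proof (rule Lim_transform_eventually[OF _ eventually_at_rightI[of 0 1], THEN tendsto_eq_rhs])
    show "S s f - S 0 f = S s f - f" by (simp add: markov_semigroup_zero[OF S])
    fix h :: real assume "h \<in> {0<..<1}"
    then show "(?F (s + h) - ?F s) /\<^sub>R h - (?F (0 + h) - ?F 0) /\<^sub>R h = (S h (?F s) - ?F s) /\<^sub>R h"
      by (simp add: shift scaleR_diff_right[symmetric]) (simp add: semigroup_integral_def)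
  qed simp
  then show ?thesis by (simp add: generator_graph_def)
qed

section \<open>The energy estimate\<close>

text \<open>
  The image of every element of the domain has mean zero, in particular \<open>S s f - f\<close>, which is the
  image of the time integral of \<open>f\<close>.
\<close>

lemma semigroup_preserves_integral:
  fixes S :: "real \<Rightarrow> ('a::topological_space \<Rightarrow>\<^sub>C real) \<Rightarrow> ('a \<Rightarrow>\<^sub>C real)"
  assumes S: "markov_semigroup S" and \<mu>: "prob_space \<mu>" "sets \<mu> = sets borel"
    and inv: "\<And>f g. (f, g) \<in> generator_graph S \<Longrightarrow> (\<integral>x. apply_bcontfun g x \<partial>\<mu>) = 0"
    and "0 \<le> s"
  shows "(\<integral>x. apply_bcontfun (S s f) x \<partial>\<mu>) = (\<integral>x. apply_bcontfun f x \<partial>\<mu>)"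
  using inv[OF semigroup_integral_in_generator_graph[OF S \<open>0 \<le> s\<close>, of f]]
    bcontfun_integrable[OF \<mu>] by simp

text \<open>
  The form in which the \<open>H\<^sub>-\<^sub>1\<close> bound for additive functionals is used here: the hypothesis
  says that the squared \<open>H\<^sub>-\<^sub>1\<close> norm of \<open>W\<close> is at most \<open>B\<close>. The proof differentiates the squared
  norm of the time integral of \<open>W\<close>. Only the quadratic form of the generator enters, and this makes
  the estimate apply to asymmetric dynamics.
\<close>

lemma semigroup_energy_estimate:
  fixes S :: "real \<Rightarrow> ('a::topological_space \<Rightarrow>\<^sub>C real) \<Rightarrow> ('a \<Rightarrow>\<^sub>C real)"
  assumes S: "markov_semigroup S" and \<mu>: "prob_space \<mu>" "sets \<mu> = sets borel"
    and bound: "\<And>f g. (f, g) \<in> generator_graph S \<Longrightarrow>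
      2 * bcontfun_inner \<mu> W f \<le> B - bcontfun_inner \<mu> f g"
    and T: "0 \<le> T"
  shows "2 * integral {0..T} (\<lambda>s. bcontfun_inner \<mu> W (semigroup_integral S W s)) \<le> 2 * B * T"
proof -
  interpret Q: bounded_bilinear "bcontfun_inner \<mu> :: ('a \<Rightarrow>\<^sub>C real) \<Rightarrow> _"
    by (rule bounded_bilinear_bcontfun_inner[OF \<mu>])
  let ?Q = "bcontfun_inner \<mu>" and ?U = "semigroup_integral S W"
  have sym: "?Q f g = ?Q g f" for f g by (simp add: bcontfun_inner_def mult.commute)
  let ?\<phi> = "\<lambda>s. ?Q (?U s) (?U s)"
  have deriv: "(?U has_vector_derivative S s W) (at s within {0..T})" if "s \<in> {0..T}" for s
    by (rule semigroup_integral_has_derivative[OF S that])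
  have "(?\<phi> has_vector_derivative 2 * ?Q (?U s) (S s W)) (at s within {0..T})" if "s \<in> {0..T}" for s
    using Q.has_vector_derivative[OF deriv[OF that] deriv[OF that]] sym[of "S s W"] by simp
  then have "((\<lambda>s. 2 * ?Q (?U s) (S s W)) has_integral ?\<phi> T - ?\<phi> 0) {0..T}"
    using T by (intro fundamental_theorem_of_calculus) auto
  then have *: "((\<lambda>s. 2 * B - 2 * ?Q (?U s) (S s W)) has_integral 2 * B * T - ?\<phi> T) {0..T}"
    using has_integral_diff[OF has_integral_const_real[of "2 * B" 0 T]] T
    by (simp add: semigroup_integral_def Q.zero_left mult.commute)
  have cont: "continuous_on {0..T} ?U"
    unfolding continuous_on_eq_continuous_within
    by (intro ballI has_vector_derivative_continuous[OF deriv])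
  \<comment> \<open>the hypothesis, applied to \<open>f = U\<^sub>s\<close> and \<open>L U\<^sub>s = S\<^sub>s W - W\<close>\<close>
  have le: "2 * ?Q W (?U s) \<le> 2 * B - 2 * ?Q (?U s) (S s W)" if "s \<in> {0..T}" for s
    using bound[OF semigroup_integral_in_generator_graph[OF S, of s W]] that sym[of W]
    by (simp add: Q.diff_right)
  have "2 * integral {0..T} (\<lambda>s. ?Q W (?U s)) = integral {0..T} (\<lambda>s. 2 * ?Q W (?U s))" by simp
  also have "\<dots> \<le> integral {0..T} (\<lambda>s. 2 * B - 2 * ?Q (?U s) (S s W))"
  proof (rule integral_le)
    show "(\<lambda>s. 2 * ?Q W (?U s)) integrable_on {0..T}"
      by (intro integrable_continuous_real continuous_intros Q.continuous_on cont)
  qed (use * le in \<open>auto simp: has_integral_iff\<close>)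
  also have "\<dots> = 2 * B * T - ?\<phi> T" using * by (simp add: has_integral_iff)
  also have "\<dots> \<le> 2 * B * T" by (simp add: bcontfun_inner_def)
  finally show ?thesis .
qed

text \<open>
  A kernel that depends only on the time difference: for fixed \<open>s\<close> the part \<open>r \<le> s\<close> contributes the
  primitive of \<open>C\<close> at \<open>s\<close> and the part \<open>r \<ge> s\<close> its value at \<open>T - s\<close>, and reflecting \<open>s\<close> shows that both
  have the same integral.
\<close>

lemma integral_stationary_kernel:
  fixes C :: "real \<Rightarrow> real"
  assumes C: "continuous_on {0..} C" and T: "0 \<le> T"
  shows "integral {0..T} (\<lambda>s. integral {0..T} (\<lambda>r. C \<bar>s - r\<bar>))
    = 2 * integral {0..T} (\<lambda>s. integral {0..s} C)"
proof -
  let ?G = "\<lambda>s. integral {0..s} C"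
  have cont: "continuous_on {0..b} C" for b by (rule continuous_on_subset[OF C]) auto
  have inner: "integral {0..T} (\<lambda>r. C \<bar>s - r\<bar>) = ?G s + ?G (T - s)" if s: "s \<in> {0..T}" for s
  proof -
    have int: "(\<lambda>r. C \<bar>s - r\<bar>) integrable_on {0..T}"
      by (intro integrable_continuous_real continuous_on_compose2[OF C] continuous_intros) auto
    have "integral {0..s} (\<lambda>r. C \<bar>s - r\<bar>) = integral {0..s} (\<lambda>r. C (s - r))"
      by (intro integral_cong) auto
    also have "\<dots> = integral {-s..0} (\<lambda>r. C (r + s))"
      using Henstock_Kurzweil_Integration.integral_reflect_real[of 0 "-s" "\<lambda>r. C (r + s)"] by (simp add: add.commute)
    also have "\<dots> = ?G s"
      using integral_shift_real_ivl[of 0 s s C] by simp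
    finally have 1: "integral {0..s} (\<lambda>r. C \<bar>s - r\<bar>) = ?G s" .
    have "integral {s..T} (\<lambda>r. C \<bar>s - r\<bar>) = integral {s..T} (\<lambda>r. C (r - s))"
      by (intro integral_cong) auto
    also have "\<dots> = ?G (T - s)"
      using integral_shift_real_ivl[of 0 "-s" "T - s" C] by simp
    finally have 2: "integral {s..T} (\<lambda>r. C \<bar>s - r\<bar>) = ?G (T - s)" .
    show ?thesis
      using Henstock_Kurzweil_Integration.integral_combine[OF _ _ int, of s] s 1 2 by simp
  qed
  have G: "continuous_on {0..T} ?G"
    by (intro indefinite_integral_continuous_1 integrable_continuous_real cont)
  have "integral {0..T} (\<lambda>s. ?G (T - s)) = integral {-T..0} (\<lambda>s. ?G (s + T))"
    using Henstock_Kurzweil_Integration.integral_reflect_real[of 0 "-T" "\<lambda>r. ?G (r + T)"] by (simp add: add.commute)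
  also have "\<dots> = integral {0..T} ?G"
    using integral_shift_real_ivl[of 0 T T ?G] by simp
  finally have refl: "integral {0..T} (\<lambda>s. ?G (T - s)) = integral {0..T} ?G" .
  have "integral {0..T} (\<lambda>s. integral {0..T} (\<lambda>r. C \<bar>s - r\<bar>)) = integral {0..T} (\<lambda>s. ?G s + ?G (T - s))"
    by (intro integral_cong inner)
  also have "\<dots> = integral {0..T} ?G + integral {0..T} (\<lambda>s. ?G (T - s))"
    by (intro Henstock_Kurzweil_Integration.integral_add integrable_continuous_real G
        continuous_on_compose2[OF G] continuous_intros) auto
  finally show ?thesis using refl by simp
qed

lemma semigroup_correlation_integral:
  fixes S :: "real \<Rightarrow> ('a::topological_space \<Rightarrow>\<^sub>C real) \<Rightarrow> ('a \<Rightarrow>\<^sub>C real)"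
  assumes S: "markov_semigroup S" and \<mu>: "prob_space \<mu>" "sets \<mu> = sets borel"
  shows "bcontfun_inner \<mu> W (semigroup_integral S W s) = integral {0..s} (\<lambda>r. bcontfun_inner \<mu> W (S r W))"
  using integral_linear[OF markov_semigroup_integrable[OF S order_refl, of W s]
      bounded_bilinear.bounded_linear_right[OF bounded_bilinear_bcontfun_inner[OF \<mu>], of W]]
  by (simp add: semigroup_integral_def o_def)

lemma continuous_on_semigroup_correlation:
  fixes S :: "real \<Rightarrow> ('a::topological_space \<Rightarrow>\<^sub>C real) \<Rightarrow> ('a \<Rightarrow>\<^sub>C real)"
  assumes S: "markov_semigroup S" and \<mu>: "prob_space \<mu>" "sets \<mu> = sets borel"
  shows "continuous_on {0..} (\<lambda>r. bcontfun_inner \<mu> W (S r W))"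
  by (intro bounded_bilinear.continuous_on[OF bounded_bilinear_bcontfun_inner[OF \<mu>]]
      continuous_on_const markov_semigroup_continuous_on S)

section \<open>Time integrals along a stationary Markov process\<close>

lemma finite_measure_time: "finite_measure (restrict_space lborel {0..T :: real})"
  by (intro finite_measureI) (simp add: emeasure_restrict_space space_restrict_space emeasure_lborel_Icc_eq)

lemma second_moment_fubini:
  fixes \<Phi> :: "'a \<Rightarrow> 'b \<Rightarrow> real"
  assumes M: "prob_space M" and L: "finite_measure L"
    and meas [measurable]: "case_prod \<Phi> \<in> borel_measurable (M \<Otimes>\<^sub>M L)"
    and bound: "\<And>\<omega> s. \<omega> \<in> space M \<Longrightarrow> s \<in> space L \<Longrightarrow> \<bar>\<Phi> \<omega> s\<bar> \<le> C"
  shows "(\<integral>\<omega>. (\<integral>s. \<Phi> \<omega> s \<partial>L)\<^sup>2 \<partial>M) = (\<integral>s. (\<integral>r. (\<integral>\<omega>. \<Phi> \<omega> s * \<Phi> \<omega> r \<partial>M) \<partial>L) \<partial>L)"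
proof -
  interpret M: prob_space M by fact
  interpret L: finite_measure L by fact
  interpret P: pair_sigma_finite M L ..
  interpret Pf: finite_measure "M \<Otimes>\<^sub>M L"
    by (rule finite_measure_pair_measure) unfold_locales
  define I where "I \<omega> = (\<integral>s. \<Phi> \<omega> s \<partial>L)" for \<omega>
  have [measurable]: "I \<in> borel_measurable M" unfolding I_def by measurable
  have \<Phi>s: "(\<lambda>s. \<Phi> \<omega> s) \<in> borel_measurable L" if "\<omega> \<in> space M" for \<omega>
    using measurable_Pair2[OF meas that] by simp
  have \<Phi>\<omega> [measurable]: "(\<lambda>\<omega>. \<Phi> \<omega> s) \<in> borel_measurable M" if "s \<in> space L" for s
    using measurable_Pair1[OF meas that] by simp
  have I_le: "\<bar>I \<omega>\<bar> \<le> \<bar>C\<bar> * measure L (space L)" if "\<omega> \<in> space M" for \<omega>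
  proof -
    have "\<bar>I \<omega>\<bar> \<le> (\<integral>s. \<bar>C\<bar> \<partial>L)"
      unfolding I_def
      using bound[OF that] \<Phi>s[OF that]
      by (intro order_trans[OF integral_abs_bound integral_mono] integrable_abs
          L.integrable_const_bound[where B = "\<bar>C\<bar>"] AE_I2) (auto intro: order_trans[OF _ abs_ge_self])
    then show ?thesis by (simp add: mult.commute)
  qed
  have "(\<integral>\<omega>. (I \<omega>)\<^sup>2 \<partial>M) = (\<integral>\<omega>. (\<integral>s. \<Phi> \<omega> s * I \<omega> \<partial>L) \<partial>M)"
    by (simp add: I_def power2_eq_square)
  also have "\<dots> = (\<integral>s. (\<integral>\<omega>. \<Phi> \<omega> s * I \<omega> \<partial>M) \<partial>L)"
  proof (rule P.Fubini_integral[symmetric])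
    have "\<bar>\<Phi> \<omega> s * I \<omega>\<bar> \<le> C * (\<bar>C\<bar> * measure L (space L))" if "\<omega> \<in> space M" "s \<in> space L" for \<omega> s
      unfolding abs_mult using bound[OF that] I_le[OF that(1)] by (intro mult_mono) auto
    then show "integrable (M \<Otimes>\<^sub>M L) (\<lambda>(\<omega>, s). \<Phi> \<omega> s * I \<omega>)"
      by (intro Pf.integrable_const_bound[where B = "C * (\<bar>C\<bar> * measure L (space L))"] AE_I2)
         (auto simp: space_pair_measure)
  qed
  also have "\<dots> = (\<integral>s. (\<integral>r. (\<integral>\<omega>. \<Phi> \<omega> s * \<Phi> \<omega> r \<partial>M) \<partial>L) \<partial>L)"
  proof (rule Bochner_Integration.integral_cong[OF refl])
    fix s assume s: "s \<in> space L"
    note [measurable] = \<Phi>\<omega>[OF s]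
    have "(\<integral>\<omega>. \<Phi> \<omega> s * I \<omega> \<partial>M) = (\<integral>\<omega>. (\<integral>r. \<Phi> \<omega> s * \<Phi> \<omega> r \<partial>L) \<partial>M)"
      by (simp add: I_def)
    also have "\<dots> = (\<integral>r. (\<integral>\<omega>. \<Phi> \<omega> s * \<Phi> \<omega> r \<partial>M) \<partial>L)"
    proof (rule P.Fubini_integral[symmetric])
      have "\<bar>\<Phi> \<omega> s * \<Phi> \<omega> r\<bar> \<le> C * C" if "\<omega> \<in> space M" "r \<in> space L" for \<omega> r
        unfolding abs_mult using bound[OF that] bound[OF that(1) s] by (intro mult_mono) auto
      then show "integrable (M \<Otimes>\<^sub>M L) (\<lambda>(\<omega>, r). \<Phi> \<omega> s * \<Phi> \<omega> r)"
        by (intro Pf.integrable_const_bound[where B = "C * C"] AE_I2)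
           (auto simp: space_pair_measure)
    qed
    finally show "(\<integral>\<omega>. \<Phi> \<omega> s * I \<omega> \<partial>M) = (\<integral>r. (\<integral>\<omega>. \<Phi> \<omega> s * \<Phi> \<omega> r \<partial>M) \<partial>L)" .
  qed
  finally show ?thesis by (simp add: I_def)
qed

text \<open>
  Second countability of the factors makes the product and the Borel sigma-algebra on configurations
  agree.
\<close>

instance bool :: second_countable_topology
proof
  show "\<exists>B :: bool set set. countable B \<and> open = generate_topology B"
  proof (intro exI conjI ext)
    show "countable (UNIV :: bool set set)" by (rule countable_finite) simp
    show "open A = generate_topology UNIV A" for A :: "bool set"
      by (auto simp: Topological_Spaces.open_discrete intro: generate_topology.Basis)
  qed
qed

lemma space_config_space [simp]: "space config_space = UNIV"
  by (auto simp: config_space_def space_PiM)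

lemma sets_config_space: "sets config_space = sets (borel :: config measure)"
proof -
  have "sets (borel :: bool measure) = sets (count_space UNIV)"
    by (auto intro!: borel_open Topological_Spaces.open_discrete)
  then have "sets config_space = sets (\<Pi>\<^sub>M x\<in>(UNIV :: int set). (borel :: bool measure))"
    unfolding config_space_def by (intro sets_PiM_cong) auto
  then show ?thesis by (simp add: sets_PiM_equal_borel)
qed

text \<open>
  The approximating times lie to the right of \<open>s\<close>, where right continuity applies, and take
  countably many values, which keeps the approximation measurable.
\<close>

lemma ceiling_approximation_tendsto:
  fixes w :: "real \<Rightarrow> 'a::topological_space"
  assumes w: "(w \<longlongrightarrow> w s) (at_right s)"
  shows "(\<lambda>n. w (of_int \<lceil>real (Suc n) * s\<rceil> / real (Suc n))) \<longlonglongrightarrow> w s"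
proof -
  let ?r = "\<lambda>n. of_int \<lceil>real (Suc n) * s\<rceil> / real (Suc n)"
  have ge: "s \<le> ?r n" for n
    by (simp add: field_simps del: of_nat_Suc) 
  have le: "?r n \<le> s + 1 / real (Suc n)" for n
  proof -
    have "of_int \<lceil>real (Suc n) * s\<rceil> \<le> real (Suc n) * s + 1" by linarith
    then show ?thesis by (simp add: field_simps del: of_nat_Suc)
  qed
  have lim: "?r \<longlonglongrightarrow> s"
  proof (rule tendsto_sandwich[OF always_eventually always_eventually tendsto_const])
    show "(\<lambda>n. s + 1 / real (Suc n)) \<longlonglongrightarrow> s"
      using tendsto_add[OF tendsto_const[of s] LIMSEQ_inverse_real_of_nat] by (simp add: inverse_eq_divide)
  qed (use ge le in auto)
  have cont: "continuous (at s within {s..}) w"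
    using w by (simp add: continuous_within at_within_Ici_at_right)
  show ?thesis
    by (rule continuous_within_tendsto_compose[OF cont _ lim]) (use ge in auto)
qed

lemma cadlag_jointly_measurable:
  fixes X :: "real \<Rightarrow> 'w \<Rightarrow> config" and f :: "config \<Rightarrow>\<^sub>C real"
  assumes X: "\<And>t. 0 \<le> t \<Longrightarrow> X t \<in> measurable M config_space"
    and cad: "\<And>\<omega>. \<omega> \<in> space M \<Longrightarrow> cadlag (\<lambda>t. X t \<omega>)"
  shows "(\<lambda>(\<omega>, s). apply_bcontfun f (X s \<omega>)) \<in> borel_measurable (M \<Otimes>\<^sub>M restrict_space lborel {0..T})"
proof -
  let ?P = "M \<Otimes>\<^sub>M restrict_space lborel {0..T}"
  let ?r = "\<lambda>n s. of_int \<lceil>real (Suc n) * s\<rceil> / real (Suc n)"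
  have f: "apply_bcontfun f \<in> borel_measurable config_space"
    by (rule apply_bcontfun_measurable[OF sets_config_space])
  have snd: "snd \<in> borel_measurable ?P"
    by (rule measurable_compose[OF measurable_snd]) (simp add: measurable_restrict_space1)
  have approx: "(\<lambda>z. apply_bcontfun f (X (?r n (snd z)) (fst z))) \<in> borel_measurable ?P" for n
  proof -
    have k: "(\<lambda>z. nat \<lceil>real (Suc n) * snd z\<rceil>) \<in> measurable ?P (count_space UNIV)"
      using snd by measurable
    have "(\<lambda>z. apply_bcontfun f (X (real (nat \<lceil>real (Suc n) * snd z\<rceil>) / real (Suc n)) (fst z)))
        \<in> borel_measurable ?P"
    proof (rule measurable_compose_countable[OF _ k])
      fix j :: nat
      show "(\<lambda>z. apply_bcontfun f (X (real j / real (Suc n)) (fst z))) \<in> borel_measurable ?P"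
        by (rule measurable_compose[OF measurable_fst measurable_compose[OF X f]]) simp
    qed
    moreover have "real (nat \<lceil>real (Suc n) * snd z\<rceil>) = of_int \<lceil>real (Suc n) * snd z\<rceil>"
      if "z \<in> space ?P" for z
      using that by (auto simp: space_pair_measure space_restrict_space)
    ultimately show ?thesis
      by (subst measurable_cong) auto
  qed
  have "(\<lambda>z. apply_bcontfun f (X (snd z) (fst z))) \<in> borel_measurable ?P"
  proof (rule borel_measurable_LIMSEQ_real[OF _ approx])
    fix z assume z: "z \<in> space ?P"
    then have "((\<lambda>t. X t (fst z)) \<longlongrightarrow> X (snd z) (fst z)) (at_right (snd z))"
      using cad[of "fst z"] by (auto simp: space_pair_measure space_restrict_space cadlag_def)
    from ceiling_approximation_tendsto[of "\<lambda>t. X t (fst z)", OF this]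
    show "(\<lambda>n. apply_bcontfun f (X (?r n (snd z)) (fst z))) \<longlonglongrightarrow> apply_bcontfun f (X (snd z) (fst z))"
      by (intro continuous_on_tendsto_compose[of UNIV "apply_bcontfun f"]) auto
  qed
  then show ?thesis by (simp add: case_prod_beta)
qed

text \<open>
  The Markov property with respect to the natural filtration, for a semigroup whose generator has
  images of mean zero under the initial law \<open>\<mu>\<close>. This last assumption is what makes the process
  stationary.
\<close>

locale stationary_markov_process = prob_space M
  for M :: "'w measure" +
  fixes X :: "real \<Rightarrow> 'w \<Rightarrow> config"
    and S :: "real \<Rightarrow> (config \<Rightarrow>\<^sub>C real) \<Rightarrow> (config \<Rightarrow>\<^sub>C real)"
    and \<mu> :: "config measure"
  assumes X_measurable: "0 \<le> t \<Longrightarrow> X t \<in> measurable M config_space"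
    and X_cadlag: "\<omega> \<in> space M \<Longrightarrow> cadlag (\<lambda>t. X t \<omega>)"
    and distr_start: "distr M config_space (X 0) = \<mu>"
    and semigroup: "markov_semigroup S"
    and markov: "0 \<le> s \<Longrightarrow> 0 \<le> t \<Longrightarrow>
      AE \<omega> in M. real_cond_exp M (natural_filtration M X s) (\<lambda>\<omega>. apply_bcontfun f (X (s + t) \<omega>)) \<omega>
             = apply_bcontfun (S t f) (X s \<omega>)"
    and invariant: "(f, g) \<in> generator_graph S \<Longrightarrow> (\<integral>x. apply_bcontfun g x \<partial>\<mu>) = 0"
begin

lemma sets_\<mu>: "sets \<mu> = sets borel"
  using distr_start sets_config_space by (metis sets_distr)

lemma prob_\<mu>: "prob_space \<mu>"
  using prob_space_distr[OF X_measurable[of 0]] distr_start by simp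

lemma bcontfun_X_measurable:
  "0 \<le> t \<Longrightarrow> (\<lambda>\<omega>. apply_bcontfun (f :: config \<Rightarrow>\<^sub>C real) (X t \<omega>)) \<in> borel_measurable M"
  by (rule measurable_compose[OF X_measurable apply_bcontfun_measurable[OF sets_config_space]])

lemma condition_on_past:
  assumes s: "0 \<le> s" and t: "0 \<le> t"
  shows "(\<integral>\<omega>. apply_bcontfun g (X s \<omega>) * apply_bcontfun f (X (s + t) \<omega>) \<partial>M)
      = (\<integral>\<omega>. apply_bcontfun g (X s \<omega>) * apply_bcontfun (S t f) (X s \<omega>) \<partial>M)"
proof -
  let ?F = "natural_filtration M X s"
  have sub: "{X u -` A \<inter> space M |u A. 0 \<le> u \<and> u \<le> s \<and> A \<in> sets config_space} \<subseteq> sets M"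
    using X_measurable by (auto intro: measurable_sets)
  then have space_F: "space ?F = space M"
    and sets_F: "sets ?F = sigma_sets (space M) {X u -` A \<inter> space M |u A. 0 \<le> u \<and> u \<le> s \<and> A \<in> sets config_space}"
    unfolding natural_filtration_def
    by (auto intro!: space_measure_of sets_measure_of dest: sets.sets_into_space)
  have "subalgebra M ?F"
    unfolding subalgebra_def using sets.sigma_sets_subset[OF sub] by (simp add: space_F sets_F)
  then interpret F: finite_measure_subalgebra M ?F
    by unfold_locales
  have "X s \<in> measurable ?F config_space"
    by (rule measurableI) (use s in \<open>auto simp: space_F sets_F\<close>)
  then have g: "(\<lambda>\<omega>. apply_bcontfun g (X s \<omega>)) \<in> borel_measurable ?F"
    by (rule measurable_compose[OF _ apply_bcontfun_measurable[OF sets_config_space]])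
  have int: "integrable M (\<lambda>\<omega>. apply_bcontfun g (X s \<omega>) * apply_bcontfun f (X (s + t) \<omega>))"
    using bcontfun_X_measurable[OF s, of g] bcontfun_X_measurable[of "s + t" f] s t
      apply_bcontfun_mult_abs_le[of g _ f]
    by (intro integrable_const_bound[where B = "norm g * norm f"]) auto
  have "(\<integral>\<omega>. apply_bcontfun g (X s \<omega>) * apply_bcontfun f (X (s + t) \<omega>) \<partial>M)
    = (\<integral>\<omega>. apply_bcontfun g (X s \<omega>) * real_cond_exp M ?F (\<lambda>\<omega>. apply_bcontfun f (X (s + t) \<omega>)) \<omega> \<partial>M)"
    using bcontfun_X_measurable[of "s + t" f] s t
    by (intro F.real_cond_exp_intg(2)[symmetric] int g) auto
  also have "\<dots> = (\<integral>\<omega>. apply_bcontfun g (X s \<omega>) * apply_bcontfun (S t f) (X s \<omega>) \<partial>M)"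
  proof (rule integral_cong_AE)
    show "AE \<omega> in M. apply_bcontfun g (X s \<omega>) * real_cond_exp M ?F (\<lambda>\<omega>. apply_bcontfun f (X (s + t) \<omega>)) \<omega>
        = apply_bcontfun g (X s \<omega>) * apply_bcontfun (S t f) (X s \<omega>)"
      using markov[OF s t, of f] by eventually_elim simp
  qed (use bcontfun_X_measurable[OF s] in auto)
  finally show ?thesis .
qed

lemma stationary:
  assumes "0 \<le> s"
  shows "(\<integral>\<omega>. apply_bcontfun h (X s \<omega>) \<partial>M) = (\<integral>x. apply_bcontfun (h :: config \<Rightarrow>\<^sub>C real) x \<partial>\<mu>)"
proof -
  have start: "(\<integral>\<omega>. apply_bcontfun h (X 0 \<omega>) \<partial>M) = (\<integral>x. apply_bcontfun h x \<partial>\<mu>)"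
    for h :: "config \<Rightarrow>\<^sub>C real"
    using integral_distr[OF X_measurable[of 0] apply_bcontfun_measurable[OF sets_config_space, of h]] distr_start
    by simp
  show ?thesis
    using condition_on_past[of 0 s "const_bcontfun 1" h] assms start
      semigroup_preserves_integral[OF semigroup prob_\<mu> sets_\<mu> invariant assms]
    by simp
qed

lemma correlation:
  assumes s: "0 \<le> s" and t: "0 \<le> t"
  shows "(\<integral>\<omega>. apply_bcontfun g (X s \<omega>) * apply_bcontfun f (X (s + t) \<omega>) \<partial>M) = bcontfun_inner \<mu> g (S t f)"
proof -
  have prod: "(\<lambda>x. apply_bcontfun g x * apply_bcontfun (S t f) x) \<in> bcontfun"
    using apply_bcontfun_mult_abs_le
    by (intro bcontfun_normI[where b = "norm g * norm (S t f)"] continuous_intros) auto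
  show ?thesis
    using condition_on_past[OF s t, of g f] stationary[OF s, of "Bcontfun (\<lambda>x. apply_bcontfun g x * apply_bcontfun (S t f) x)"]
    by (simp add: Bcontfun_inverse[OF prod] bcontfun_inner_def)
qed

lemma correlation_abs:
  assumes s: "0 \<le> s" and r: "0 \<le> r"
  shows "(\<integral>\<omega>. apply_bcontfun f (X s \<omega>) * apply_bcontfun f (X r \<omega>) \<partial>M) = bcontfun_inner \<mu> f (S \<bar>s - r\<bar> f)"
proof (cases "s \<le> r")
  case True
  then show ?thesis using correlation[OF s, of "r - s" f f] by (simp add: abs_minus_commute)
next
  case False
  then show ?thesis using correlation[OF r, of "s - r" f f] by (simp add: mult.commute)
qed

text \<open>
  Both factors have the law \<open>\<mu>\<close>, so \<open>2 a b \<le> a\<^sup>2 + b\<^sup>2\<close> bounds every correlation by the one at time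
  \<open>0\<close>.
\<close>

lemma correlation_le:
  assumes "0 \<le> t"
  shows "bcontfun_inner \<mu> f (S t f) \<le> bcontfun_inner \<mu> f f"
proof -
  have sq: "(\<lambda>x. apply_bcontfun f x * apply_bcontfun f x) \<in> bcontfun"
    by (intro bcontfun_normI[where b = "norm f * norm f"] continuous_intros)
       (auto simp only: real_norm_def apply_bcontfun_mult_abs_le continuous_on_apply_bcontfun)
  have second: "(\<integral>\<omega>. apply_bcontfun f (X s \<omega>) * apply_bcontfun f (X s \<omega>) \<partial>M) = bcontfun_inner \<mu> f f"
    if "0 \<le> s" for s
    using stationary[OF that, of "Bcontfun (\<lambda>x. apply_bcontfun f x * apply_bcontfun f x)"]
    by (simp add: Bcontfun_inverse[OF sq] bcontfun_inner_def)
  have int: "integrable M (\<lambda>\<omega>. apply_bcontfun f (X s \<omega>) * apply_bcontfun f (X r \<omega>))"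
    if "0 \<le> s" "0 \<le> r" for s r
    using bcontfun_X_measurable[OF that(1), of f] bcontfun_X_measurable[OF that(2), of f]
      apply_bcontfun_mult_abs_le[of f _ f]
    by (intro integrable_const_bound[where B = "norm f * norm f"]) auto
  have "bcontfun_inner \<mu> f (S t f) = (\<integral>\<omega>. apply_bcontfun f (X 0 \<omega>) * apply_bcontfun f (X t \<omega>) \<partial>M)"
    using correlation[of 0 t f f] assms by simp
  also have "\<dots> \<le> (\<integral>\<omega>. (apply_bcontfun f (X 0 \<omega>) * apply_bcontfun f (X 0 \<omega>)
      + apply_bcontfun f (X t \<omega>) * apply_bcontfun f (X t \<omega>)) / 2 \<partial>M)"
  proof (rule integral_mono)
    fix \<omega>
    show "apply_bcontfun f (X 0 \<omega>) * apply_bcontfun f (X t \<omega>) \<le> (apply_bcontfun f (X 0 \<omega>) * apply_bcontfun f (X 0 \<omega>)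
      + apply_bcontfun f (X t \<omega>) * apply_bcontfun f (X t \<omega>)) / 2"
      using sum_squares_bound[of "apply_bcontfun f (X 0 \<omega>)" "apply_bcontfun f (X t \<omega>)"]
      by (simp add: power2_eq_square)
  qed (use int assms in auto)
  also have "\<dots> = bcontfun_inner \<mu> f f"
    using int assms by (simp add: second)
  finally show ?thesis .
qed

lemma jointly_measurable:
  "(\<lambda>(\<omega>, s). apply_bcontfun (f :: config \<Rightarrow>\<^sub>C real) (X s \<omega>))
    \<in> borel_measurable (M \<Otimes>\<^sub>M restrict_space lborel {0..T})"
  by (rule cadlag_jointly_measurable[OF X_measurable X_cadlag])

lemma continuous_on_correlation_inner:
  "continuous_on {0..T} (\<lambda>r. bcontfun_inner \<mu> f (S \<bar>s - r\<bar> f))"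
  by (intro continuous_on_compose2[OF continuous_on_semigroup_correlation[OF semigroup prob_\<mu> sets_\<mu>]]
      continuous_intros) auto

lemma continuous_on_correlation_outer:
  assumes "0 \<le> T"
  shows "continuous_on {0..T} (\<lambda>s. integral {0..T} (\<lambda>r. bcontfun_inner \<mu> f (S \<bar>s - r\<bar> f)))"
proof -
  have "continuous_on ({0..T} \<times> cbox 0 T) (\<lambda>(s, r). bcontfun_inner \<mu> f (S \<bar>s - r\<bar> f))"
    unfolding case_prod_unfold
    by (intro continuous_on_compose2[OF continuous_on_semigroup_correlation[OF semigroup prob_\<mu> sets_\<mu>]]
      continuous_intros) auto
  from integral_continuous_on_param[OF this] show ?thesis by simp
qed

lemma time_integral_second_moment:
  assumes T: "0 \<le> T"
  shows "(\<integral>\<omega>. (\<integral>s. apply_bcontfun f (X s \<omega>) \<partial>restrict_space lborel {0..T})\<^sup>2 \<partial>M)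
    = integral {0..T} (\<lambda>s. integral {0..T} (\<lambda>r. bcontfun_inner \<mu> f (S \<bar>s - r\<bar> f)))"
proof -
  let ?L = "restrict_space lborel {0..T}"
  have L_HK: "(\<integral>s. g s \<partial>?L) = integral {0..T} g" if "continuous_on {0..T} g" for g :: "real \<Rightarrow> real"
    using set_borel_integral_eq_integral(2)[OF borel_integrable_atLeastAtMost'[OF that]]
    by (simp add: integral_restrict_space set_lebesgue_integral_def)
  note inner = continuous_on_correlation_inner[of T f] and outer = continuous_on_correlation_outer[OF T, of f]
  let ?C = "\<lambda>u. bcontfun_inner \<mu> f (S u f)"
  have "(\<integral>\<omega>. (\<integral>s. apply_bcontfun f (X s \<omega>) \<partial>?L)\<^sup>2 \<partial>M)
      = (\<integral>s. (\<integral>r. (\<integral>\<omega>. apply_bcontfun f (X s \<omega>) * apply_bcontfun f (X r \<omega>) \<partial>M) \<partial>?L) \<partial>?L)"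
    by (rule second_moment_fubini[OF prob_space_axioms finite_measure_time jointly_measurable apply_bcontfun_abs_le])
  also have "\<dots> = (\<integral>s. (\<integral>r. ?C \<bar>s - r\<bar> \<partial>?L) \<partial>?L)"
    by (intro Bochner_Integration.integral_cong refl correlation_abs) (auto simp: space_restrict_space)
  also have "\<dots> = integral {0..T} (\<lambda>s. integral {0..T} (\<lambda>r. ?C \<bar>s - r\<bar>))"
    by (simp add: L_HK inner outer)
  finally show ?thesis .
qed

text \<open>
  The second moment is twice the time integral in the energy estimate, so it grows at most linearly
  in \<open>T\<close>.
\<close>

lemma time_integral_energy_bound:
  assumes T: "0 \<le> T"
    and bound: "\<And>f g. (f, g) \<in> generator_graph S \<Longrightarrow>
      2 * bcontfun_inner \<mu> W f \<le> B - bcontfun_inner \<mu> f g"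
  shows "(\<integral>\<omega>. (\<integral>s. apply_bcontfun W (X s \<omega>) \<partial>restrict_space lborel {0..T})\<^sup>2 \<partial>M) \<le> 2 * B * T"
  using semigroup_energy_estimate[OF semigroup prob_\<mu> sets_\<mu> bound T]
  unfolding time_integral_second_moment[OF T]
    integral_stationary_kernel[OF continuous_on_semigroup_correlation[OF semigroup prob_\<mu> sets_\<mu>] T]
    semigroup_correlation_integral[OF semigroup prob_\<mu> sets_\<mu>] .

text \<open>
  Each correlation is estimated by the second moment of \<open>f\<close> under \<open>\<mu>\<close>, without cancellation in time, so
  the bound grows quadratically in \<open>T\<close>. It serves for functions whose variance is small already.
\<close>

lemma time_integral_static_bound:
  assumes T: "0 \<le> T"
  shows "(\<integral>\<omega>. (\<integral>s. apply_bcontfun f (X s \<omega>) \<partial>restrict_space lborel {0..T})\<^sup>2 \<partial>M)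
    \<le> T\<^sup>2 * bcontfun_inner \<mu> f f"
proof -
  note inner = continuous_on_correlation_inner[of T f] and outer = continuous_on_correlation_outer[OF T, of f]
  let ?C = "\<lambda>u. bcontfun_inner \<mu> f (S u f)"
  have "integral {0..T} (\<lambda>s. integral {0..T} (\<lambda>r. ?C \<bar>s - r\<bar>))
      \<le> integral {0..T} (\<lambda>s. integral {0..T} (\<lambda>r. bcontfun_inner \<mu> f f))"
    by (intro integral_le integrable_continuous_real inner outer continuous_on_const correlation_le) auto
  then show ?thesis
    unfolding time_integral_second_moment[OF T] using T by (simp add: power2_eq_square mult_ac)
qed

lemma path_measurable:
  assumes "\<omega> \<in> space M"
  shows "(\<lambda>s. apply_bcontfun (f :: config \<Rightarrow>\<^sub>C real) (X s \<omega>)) \<in> borel_measurable (restrict_space lborel {0..T})"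
  using measurable_Pair2[OF jointly_measurable assms, of f T] by simp

lemma time_integral_measurable:
  "(\<lambda>\<omega>. \<integral>s. apply_bcontfun (f :: config \<Rightarrow>\<^sub>C real) (X s \<omega>) \<partial>restrict_space lborel {0..T}) \<in> borel_measurable M"
proof -
  interpret sigma_finite_measure "restrict_space lborel {0..T}"
    by (rule sigma_finite_measure_restrict_space) (auto intro: lborel.sigma_finite_measure_axioms)
  show ?thesis using jointly_measurable[of f T] by (rule borel_measurable_lebesgue_integral)
qed

lemma path_integrable:
  assumes "\<omega> \<in> space M"
  shows "integrable (restrict_space lborel {0..T}) (\<lambda>s. apply_bcontfun (f :: config \<Rightarrow>\<^sub>C real) (X s \<omega>))"
  using path_measurable[OF assms, of f T] apply_bcontfun_abs_le[of f]
  by (intro finite_measure.integrable_const_bound[OF finite_measure_time, where B = "norm f"]) auto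

lemma time_integral_abs_le:
  assumes "\<omega> \<in> space M" "0 \<le> T" and le: "\<And>\<eta>. \<bar>apply_bcontfun f \<eta>\<bar> \<le> D"
  shows "\<bar>\<integral>s. apply_bcontfun f (X s \<omega>) \<partial>restrict_space lborel {0..T}\<bar> \<le> D * T"
proof -
  interpret finite_measure "restrict_space lborel {0..T}" by (rule finite_measure_time)
  have "\<bar>\<integral>s. apply_bcontfun f (X s \<omega>) \<partial>restrict_space lborel {0..T}\<bar> \<le> (\<integral>s. D \<partial>restrict_space lborel {0..T})"
    by (intro order_trans[OF integral_abs_bound integral_mono] integrable_abs path_integrable assms) auto
  then show ?thesis
    using \<open>0 \<le> T\<close> by (simp add: measure_restrict_space space_restrict_space mult.commute)
qed

lemma time_integral_square_integrable:
  fixes f :: "config \<Rightarrow>\<^sub>C real"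
  assumes "0 \<le> T"
  shows "integrable M (\<lambda>\<omega>. (\<integral>s. apply_bcontfun f (X s \<omega>) \<partial>restrict_space lborel {0..T})\<^sup>2)"
  using time_integral_measurable[of T f] power_mono[OF time_integral_abs_le[OF _ assms apply_bcontfun_abs_le[of f]], where n = 2]
  by (intro integrable_const_bound[where B = "(norm f * T)\<^sup>2"]) auto

lemma time_integral_second_moment_add:
  fixes V f g :: "config \<Rightarrow>\<^sub>C real"
  assumes T: "0 \<le> T" and eq: "\<And>\<eta>. apply_bcontfun V \<eta> = apply_bcontfun f \<eta> + apply_bcontfun g \<eta>"
  shows "(\<integral>\<omega>. (\<integral>s. apply_bcontfun V (X s \<omega>) \<partial>restrict_space lborel {0..T})\<^sup>2 \<partial>M)
    \<le> 2 * (\<integral>\<omega>. (\<integral>s. apply_bcontfun f (X s \<omega>) \<partial>restrict_space lborel {0..T})\<^sup>2 \<partial>M)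
     + 2 * (\<integral>\<omega>. (\<integral>s. apply_bcontfun g (X s \<omega>) \<partial>restrict_space lborel {0..T})\<^sup>2 \<partial>M)"
proof -
  let ?I = "\<lambda>f \<omega>. \<integral>s. apply_bcontfun (f :: config \<Rightarrow>\<^sub>C real) (X s \<omega>) \<partial>restrict_space lborel {0..T}"
  have "(\<integral>\<omega>. (?I V \<omega>)\<^sup>2 \<partial>M) \<le> (\<integral>\<omega>. 2 * (?I f \<omega>)\<^sup>2 + 2 * (?I g \<omega>)\<^sup>2 \<partial>M)"
  proof (rule integral_mono)
    fix \<omega> assume \<omega>: "\<omega> \<in> space M"
    have "?I V \<omega> = ?I f \<omega> + ?I g \<omega>"
      by (simp add: eq path_integrable[OF \<omega>])
    then show "(?I V \<omega>)\<^sup>2 \<le> 2 * (?I f \<omega>)\<^sup>2 + 2 * (?I g \<omega>)\<^sup>2"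
      using sum_squares_bound[of "?I f \<omega>" "?I g \<omega>"] by (simp add: power2_sum)
  qed (intro Bochner_Integration.integrable_add integrable_mult_right time_integral_square_integrable T)+
  then show ?thesis by (simp add: time_integral_square_integrable T)
qed

text \<open>
  Bounds for finite sums pass to infinite sums along this lemma; boundedness by \<open>D\<close> allows dominated
  convergence first in time and then in the probability space.
\<close>

lemma time_integral_second_moment_limit:
  fixes V :: "nat \<Rightarrow> config \<Rightarrow>\<^sub>C real" and v :: "config \<Rightarrow> real"
  assumes T: "0 \<le> T" and lim: "\<And>\<eta>. (\<lambda>n. apply_bcontfun (V n) \<eta>) \<longlonglongrightarrow> v \<eta>"
    and le: "\<And>n \<eta>. \<bar>apply_bcontfun (V n) \<eta>\<bar> \<le> D"
    and bound: "\<And>n. (\<integral>\<omega>. (\<integral>s. apply_bcontfun (V n) (X s \<omega>) \<partial>restrict_space lborel {0..T})\<^sup>2 \<partial>M) \<le> E"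
  shows "(\<integral>\<omega>. (\<integral>s. v (X s \<omega>) \<partial>restrict_space lborel {0..T})\<^sup>2 \<partial>M) \<le> E"
proof -
  let ?L = "restrict_space lborel {0..T}"
  interpret L: finite_measure ?L by (rule finite_measure_time)
  let ?I = "\<lambda>n \<omega>. \<integral>s. apply_bcontfun (V n) (X s \<omega>) \<partial>?L"
  have conv: "(\<lambda>n. ?I n \<omega>) \<longlonglongrightarrow> (\<integral>s. v (X s \<omega>) \<partial>?L)" if \<omega>: "\<omega> \<in> space M" for \<omega>
  proof (rule integral_dominated_convergence[where w = "\<lambda>_. D"])
    show "(\<lambda>s. v (X s \<omega>)) \<in> borel_measurable ?L"
      by (rule borel_measurable_LIMSEQ_real[OF lim path_measurable[OF \<omega>]])
  qed (use lim le path_measurable[OF \<omega>] in auto)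
  have "(\<lambda>n. \<integral>\<omega>. (?I n \<omega>)\<^sup>2 \<partial>M) \<longlonglongrightarrow> (\<integral>\<omega>. (\<integral>s. v (X s \<omega>) \<partial>?L)\<^sup>2 \<partial>M)"
  proof (rule integral_dominated_convergence[where w = "\<lambda>_. (D * T)\<^sup>2"])
    show "(\<lambda>\<omega>. (\<integral>s. v (X s \<omega>) \<partial>?L)\<^sup>2) \<in> borel_measurable M"
      by (intro borel_measurable_power borel_measurable_LIMSEQ_real[OF conv time_integral_measurable])
    show "(\<lambda>\<omega>. (?I n \<omega>)\<^sup>2) \<in> borel_measurable M" for n
      by (intro borel_measurable_power time_integral_measurable)
    show "AE \<omega> in M. (\<lambda>n. (?I n \<omega>)\<^sup>2) \<longlonglongrightarrow> (\<integral>s. v (X s \<omega>) \<partial>?L)\<^sup>2"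
      by (intro AE_I2 tendsto_power conv)
    show "AE \<omega> in M. norm ((?I n \<omega>)\<^sup>2) \<le> (D * T)\<^sup>2" for n
    proof (rule AE_I2)
      fix \<omega> assume "\<omega> \<in> space M"
      from power_mono[OF time_integral_abs_le[OF this T le], where n = 2]
      show "norm ((?I n \<omega>)\<^sup>2) \<le> (D * T)\<^sup>2" by simp
    qed
  qed auto
  then show ?thesis by (rule LIMSEQ_le_const2) (use bound in auto)
qed

end

section \<open>The Bernoulli product measure\<close>

lemma sets_bernoulli_measure: "sets (bernoulli_measure \<alpha>) = sets config_space"
  unfolding bernoulli_measure_def config_space_def by (intro sets_PiM_cong) auto

lemma measurable_bernoulli_iff: "measurable (bernoulli_measure \<alpha>) N = measurable config_space N"
  by (intro measurable_cong_sets sets_bernoulli_measure refl)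

lemma measurable_into_bernoulli_iff: "measurable N (bernoulli_measure \<alpha>) = measurable N config_space"
  by (intro measurable_cong_sets sets_bernoulli_measure refl)

lemma space_bernoulli_measure [simp]: "space (bernoulli_measure \<alpha>) = UNIV"
  by (auto simp: bernoulli_measure_def space_PiM)

lemma prob_space_bernoulli_measure: "prob_space (bernoulli_measure \<alpha>)"
  unfolding bernoulli_measure_def by (intro prob_space_PiM prob_space_measure_pmf)

lemma bernoulli_sets_borel: "sets (bernoulli_measure \<alpha>) = sets borel"
  by (simp add: sets_bernoulli_measure sets_config_space)

lemma bcontfun_config_measurable [measurable]:
  "apply_bcontfun (f :: config \<Rightarrow>\<^sub>C real) \<in> borel_measurable config_space"
  by (rule apply_bcontfun_measurable[OF sets_config_space])

lemma coordinate_measurable [measurable]: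
  "(\<lambda>\<eta>. \<eta> x) \<in> measurable config_space (count_space UNIV)"
  unfolding config_space_def by (rule measurable_component_singleton) simp

lemma exchange_commute: "exchange \<eta> x y = exchange \<eta> y x"
  by (auto simp: exchange_def fun_eq_iff)

lemma exchange_exchange [simp]: "exchange (exchange \<eta> x y) x y = \<eta>"
  by (auto simp: exchange_def fun_eq_iff)

lemma exchange_measurable [measurable]: "(\<lambda>\<eta>. exchange \<eta> x y) \<in> measurable config_space config_space"
  unfolding config_space_def
proof (rule measurable_PiM_single')
  fix z :: int
  have "(\<lambda>\<eta>. exchange \<eta> x y z) = (\<lambda>\<eta>. \<eta> (if z = y then x else if z = x then y else z))"
    by (auto simp: exchange_def)
  then show "(\<lambda>\<eta>. exchange \<eta> x y z) \<in> measurable (\<Pi>\<^sub>M x\<in>UNIV. count_space UNIV) (count_space UNIV)"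
    using coordinate_measurable[unfolded config_space_def] by simp
qed (simp add: space_PiM)

text \<open>
  An exchange of two sites permutes the factors of a product of identical measures.
\<close>

lemma distr_exchange_bernoulli:
  "distr (bernoulli_measure \<alpha>) (bernoulli_measure \<alpha>) (\<lambda>\<eta>. exchange \<eta> x y) = bernoulli_measure \<alpha>"
proof -
  let ?f = "\<lambda>z. if z = y then x else if z = x then y else z"
  have "(\<lambda>\<eta>. exchange \<eta> x y) = (\<lambda>\<eta>. \<lambda>n\<in>UNIV. \<eta> (?f n))"
    by (auto simp: exchange_def fun_eq_iff)
  moreover have "inj ?f" by (auto simp: inj_def split: if_splits)
  ultimately show ?thesis
    using distr_PiM_reindex[of UNIV "\<lambda>_::int. measure_pmf (bernoulli_pmf \<alpha>)" ?f UNIV]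
    by (simp add: bernoulli_measure_def prob_space_measure_pmf)
qed

lemma integral_exchange_bernoulli:
  fixes f :: "config \<Rightarrow> real"
  assumes "f \<in> borel_measurable config_space"
  shows "(\<integral>\<eta>. f (exchange \<eta> x y) \<partial>bernoulli_measure \<alpha>) = (\<integral>\<eta>. f \<eta> \<partial>bernoulli_measure \<alpha>)"
proof -
  have m: "f \<in> borel_measurable (bernoulli_measure \<alpha>)"
      "(\<lambda>\<eta>. exchange \<eta> x y) \<in> measurable (bernoulli_measure \<alpha>) (bernoulli_measure \<alpha>)"
    using assms by (simp_all add: measurable_bernoulli_iff measurable_into_bernoulli_iff)
  show ?thesis
    using integral_distr[OF m(2,1)] by (simp add: distr_exchange_bernoulli)
qed

text \<open>
  Exchanges are self-adjoint in \<open>L\<^sup>2(\<nu>\<^sub>\<alpha>)\<close>. Invariance, the Dirichlet form and the integration by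
  parts for gradients all rest on this.
\<close>

lemma integral_move_exchange:
  fixes c f :: "config \<Rightarrow> real"
  assumes f: "f \<in> borel_measurable config_space" and c: "c \<in> borel_measurable config_space"
  shows "(\<integral>\<eta>. c \<eta> * f (exchange \<eta> x y) \<partial>bernoulli_measure \<alpha>)
    = (\<integral>\<eta>. c (exchange \<eta> x y) * f \<eta> \<partial>bernoulli_measure \<alpha>)"
proof -
  have "(\<lambda>\<eta>. c (exchange \<eta> x y) * f \<eta>) \<in> borel_measurable config_space"
    using f c by measurable
  from integral_exchange_bernoulli[OF this, where \<alpha> = \<alpha> and x = x and y = y] show ?thesis by simp
qed

lemma bernoulli_integrable_bounded:
  assumes "f \<in> borel_measurable config_space" "\<And>\<eta>. \<bar>f \<eta>\<bar> \<le> (C::real)"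
  shows "integrable (bernoulli_measure \<alpha>) f"
proof -
  interpret prob_space "bernoulli_measure \<alpha>" by (rule prob_space_bernoulli_measure)
  show ?thesis
    using assms by (intro integrable_const_bound[where B = C]) (auto simp: measurable_bernoulli_iff)
qed

lemma bernoulli_integrable_mult:
  assumes "f \<in> borel_measurable config_space" "\<And>\<eta>. \<bar>f \<eta>\<bar> \<le> (C::real)"
    and "g \<in> borel_measurable config_space" "\<And>\<eta>. \<bar>g \<eta>\<bar> \<le> (D::real)"
  shows "integrable (bernoulli_measure \<alpha>) (\<lambda>\<eta>. f \<eta> * g \<eta>)"
  using assms by (intro bernoulli_integrable_bounded[where C = "C * D"] abs_mult_le) auto

text \<open>
  Independence of one coordinate from all others: it may be drawn afresh.
\<close>

lemma bernoulli_integral_resample: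
  assumes f: "f \<in> borel_measurable config_space" "\<And>\<eta>. \<bar>f \<eta>\<bar> \<le> C" and "0 \<le> \<alpha>" "\<alpha> \<le> 1"
  shows "(\<integral>\<eta>. f \<eta> \<partial>bernoulli_measure \<alpha>)
    = (\<integral>\<eta>. \<alpha> * f (\<eta>(x := True)) + (1 - \<alpha>) * f (\<eta>(x := False)) \<partial>bernoulli_measure \<alpha>)"
proof -
  let ?b = "measure_pmf (bernoulli_pmf \<alpha>)" and ?\<nu> = "bernoulli_measure \<alpha>"
  interpret b: prob_space ?b by (rule prob_space_measure_pmf)
  interpret \<nu>: prob_space ?\<nu> by (rule prob_space_bernoulli_measure)
  interpret pair_prob_space ?b ?\<nu> ..
  have up: "(\<lambda>(u, \<eta>). \<eta>(x := u)) \<in> measurable (?b \<Otimes>\<^sub>M ?\<nu>) ?\<nu>"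
    unfolding bernoulli_measure_def case_prod_beta
    by (rule measurable_fun_upd[where J = UNIV]) auto
  have m: "f \<in> borel_measurable ?\<nu>" using f(1) by (simp add: measurable_bernoulli_iff)
  have "distr (?b \<Otimes>\<^sub>M ?\<nu>) ?\<nu> (\<lambda>(u, \<eta>). \<eta>(x := u)) = ?\<nu>"
    using distr_pair_PiM_eq_PiM[of UNIV "\<lambda>_::int. ?b" x]
    by (simp add: bernoulli_measure_def prob_space_measure_pmf)
  then have "(\<integral>\<eta>. f \<eta> \<partial>?\<nu>) = (\<integral>(u, \<eta>). f (\<eta>(x := u)) \<partial>(?b \<Otimes>\<^sub>M ?\<nu>))"
    using integral_distr[OF up m] by (simp add: case_prod_unfold)
  also have "\<dots> = (\<integral>\<eta>. (\<integral>u. f (\<eta>(x := u)) \<partial>?b) \<partial>?\<nu>)"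
  proof (subst integral_snd)
    have "(\<lambda>z. f ((snd z)(x := fst z))) \<in> borel_measurable (?b \<Otimes>\<^sub>M ?\<nu>)"
      using measurable_compose[OF up m] by (simp add: case_prod_beta)
    then show "integrable (?b \<Otimes>\<^sub>M ?\<nu>) (\<lambda>(u, \<eta>). f (\<eta>(x := u)))"
      by (intro integrable_const_bound[where B = C]) (auto simp: f(2) case_prod_beta)
  qed (simp add: case_prod_beta)
  finally show ?thesis using assms(3,4) by (simp add: mult.commute)
qed

lemma centered_measurable [measurable]:
  "(\<lambda>\<eta>. centered \<alpha> \<eta> x) \<in> borel_measurable config_space"
  unfolding centered_def by measurable

lemma centered_abs_le: "0 \<le> \<alpha> \<Longrightarrow> \<alpha> \<le> 1 \<Longrightarrow> \<bar>centered \<alpha> \<eta> x\<bar> \<le> 1"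
  by (auto simp: centered_def)

lemma centered_exchange [simp]:
  "centered \<alpha> (exchange \<eta> x y) x = centered \<alpha> \<eta> y"
  "centered \<alpha> (exchange \<eta> x y) y = centered \<alpha> \<eta> x"
  by (simp_all add: centered_def exchange_def)

lemma bernoulli_integral_centered_mult:
  assumes g: "g \<in> borel_measurable config_space" "\<And>\<eta>. \<bar>g \<eta>\<bar> \<le> C" and \<alpha>: "0 \<le> \<alpha>" "\<alpha> \<le> 1"
    and free: "\<And>\<eta> u. g (\<eta>(x := u)) = g \<eta>"
  shows "(\<integral>\<eta>. centered \<alpha> \<eta> x * g \<eta> \<partial>bernoulli_measure \<alpha>) = 0"
proof -
  have m: "(\<lambda>\<eta>. centered \<alpha> \<eta> x * g \<eta>) \<in> borel_measurable config_space"
    using g(1) by measurable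
  have "\<bar>centered \<alpha> \<eta> x * g \<eta>\<bar> \<le> 1 * C" for \<eta>
    unfolding abs_mult using g(2) centered_abs_le[OF \<alpha>]
    by (intro mult_mono) auto
  then have "(\<integral>\<eta>. centered \<alpha> \<eta> x * g \<eta> \<partial>bernoulli_measure \<alpha>) = (\<integral>\<eta>. 0 \<partial>bernoulli_measure \<alpha>)"
    by (subst bernoulli_integral_resample[OF m _ \<alpha>, where x = x and C = "1 * C"])
       (assumption, auto simp: free centered_def algebra_simps)
  then show ?thesis by simp
qed

text \<open>
  Pythagoras: the cross terms vanish, and the bound \<open>1\<close> on the functions keeps every diagonal term below
  the squared coefficient.
\<close>

lemma bernoulli_integral_sum_square_le:
  fixes \<psi> :: "'i \<Rightarrow> config \<Rightarrow> real"
  assumes I: "finite I" and m: "\<And>i. i \<in> I \<Longrightarrow> \<psi> i \<in> borel_measurable config_space"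
    and le: "\<And>i \<eta>. i \<in> I \<Longrightarrow> \<bar>\<psi> i \<eta>\<bar> \<le> 1"
    and orth: "\<And>i j. i \<in> I \<Longrightarrow> j \<in> I \<Longrightarrow> i \<noteq> j \<Longrightarrow> (\<integral>\<eta>. \<psi> i \<eta> * \<psi> j \<eta> \<partial>bernoulli_measure \<alpha>) = 0"
  shows "(\<integral>\<eta>. (\<Sum>i\<in>I. c i * \<psi> i \<eta>)\<^sup>2 \<partial>bernoulli_measure \<alpha>) \<le> (\<Sum>i\<in>I. (c i)\<^sup>2)"
proof -
  interpret prob_space "bernoulli_measure \<alpha>" by (rule prob_space_bernoulli_measure)
  have int: "integrable (bernoulli_measure \<alpha>) (\<lambda>\<eta>. \<psi> i \<eta> * \<psi> j \<eta>)" if "i \<in> I" "j \<in> I" for i j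
    using m le that by (intro bernoulli_integrable_mult[where C = 1 and D = 1]) auto
  have "(\<integral>\<eta>. (\<Sum>i\<in>I. c i * \<psi> i \<eta>)\<^sup>2 \<partial>bernoulli_measure \<alpha>)
      = (\<integral>\<eta>. (\<Sum>i\<in>I. \<Sum>j\<in>I. (c i * c j) * (\<psi> i \<eta> * \<psi> j \<eta>)) \<partial>bernoulli_measure \<alpha>)"
    by (simp add: power2_eq_square sum_product algebra_simps)
  also have "\<dots> = (\<Sum>i\<in>I. \<Sum>j\<in>I. (c i * c j) * (\<integral>\<eta>. \<psi> i \<eta> * \<psi> j \<eta> \<partial>bernoulli_measure \<alpha>))"
    by (simp add: int)
  also have "\<dots> = (\<Sum>i\<in>I. \<Sum>j\<in>I. if j = i then (c i)\<^sup>2 * (\<integral>\<eta>. \<psi> i \<eta> * \<psi> i \<eta> \<partial>bernoulli_measure \<alpha>) else 0)"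
    by (intro sum.cong refl) (auto simp: power2_eq_square orth)
  also have "\<dots> = (\<Sum>i\<in>I. (c i)\<^sup>2 * (\<integral>\<eta>. \<psi> i \<eta> * \<psi> i \<eta> \<partial>bernoulli_measure \<alpha>))"
    using I by simp
  also have "\<dots> \<le> (\<Sum>i\<in>I. (c i)\<^sup>2 * 1)"
  proof (intro sum_mono mult_left_mono)
    fix i assume i: "i \<in> I"
    have "\<bar>\<psi> i \<eta> * \<psi> i \<eta>\<bar> \<le> 1 * 1" for \<eta> by (intro abs_mult_le le i)
    then have "(\<integral>\<eta>. \<psi> i \<eta> * \<psi> i \<eta> \<partial>bernoulli_measure \<alpha>) \<le> (\<integral>\<eta>. 1 \<partial>bernoulli_measure \<alpha>)"
      by (intro integral_mono int i) (auto simp: abs_le_iff)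
    then show "(\<integral>\<eta>. \<psi> i \<eta> * \<psi> i \<eta> \<partial>bernoulli_measure \<alpha>) \<le> 1" using prob_space by simp
  qed auto
  finally show ?thesis by simp
qed

section \<open>The exclusion generator on local functions\<close>

abbreviation bond_swap :: "config \<Rightarrow> int \<Rightarrow> config" where
  "bond_swap \<eta> x \<equiv> exchange \<eta> x (x + 1)"

text \<open>
  The total rate at which the values at \<open>x\<close> and \<open>x + 1\<close> are exchanged: a particle jumps across the
  bond from the left or from the right.
\<close>

definition bond_rate :: "real \<Rightarrow> config \<Rightarrow> int \<Rightarrow> real" where
  "bond_rate p \<eta> x = p * of_bool (\<eta> x) * (1 - of_bool (\<eta> (x + 1)))
     + (1 - p) * of_bool (\<eta> (x + 1)) * (1 - of_bool (\<eta> x))"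

lemma bond_rate_measurable [measurable]: "(\<lambda>\<eta>. bond_rate p \<eta> x) \<in> borel_measurable config_space"
  unfolding bond_rate_def by measurable

lemma bond_rate_abs_le: "0 \<le> p \<Longrightarrow> p \<le> 1 \<Longrightarrow> \<bar>bond_rate p \<eta> x\<bar> \<le> 1"
  by (auto simp: bond_rate_def)

lemma finite_int_set_subset_interval:
  fixes F :: "int set"
  assumes "finite F"
  obtains m :: nat where "F \<subseteq> {-int m..int m}"
proof (rule that[of "nat (\<Sum>x\<in>F. \<bar>x\<bar>)"])
  have "\<bar>x\<bar> \<le> int (nat (\<Sum>x\<in>F. \<bar>x\<bar>))" if "x \<in> F" for x
    using member_le_sum[OF that _ assms, of abs] by simp
  then show "F \<subseteq> {-int (nat (\<Sum>x\<in>F. \<bar>x\<bar>))..int (nat (\<Sum>x\<in>F. \<bar>x\<bar>))}"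
    by (fastforce simp: abs_le_iff)
qed

definition depends_on :: "int set \<Rightarrow> (config \<Rightarrow> real) \<Rightarrow> bool" where
  "depends_on A f \<longleftrightarrow> (\<forall>\<eta> \<zeta>. (\<forall>x\<in>A. \<eta> x = \<zeta> x) \<longrightarrow> f \<eta> = f \<zeta>)"

lemma depends_on_mono:
  assumes f: "depends_on A f" and AB: "A \<subseteq> B"
  shows "depends_on B f"
  unfolding depends_on_def
proof (intro allI impI)
  fix \<eta> \<zeta> :: config assume "\<forall>x\<in>B. \<eta> x = \<zeta> x"
  then have "\<forall>x\<in>A. \<eta> x = \<zeta> x" using AB by blast
  then show "f \<eta> = f \<zeta>" using f unfolding depends_on_def by blast
qed

lemma local_function_depends_on:
  assumes "local_function f"
  obtains b where "0 \<le> b" "depends_on {-b..b} f"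
proof -
  obtain A where A: "finite A" "\<And>\<eta> \<zeta>. (\<forall>x\<in>A. \<eta> x = \<zeta> x) \<Longrightarrow> f \<eta> = f \<zeta>"
    using assms unfolding local_function_def by blast
  obtain m :: nat where "A \<subseteq> {-int m..int m}"
    by (rule finite_int_set_subset_interval[OF A(1)])
  then show ?thesis
    by (intro that[of "int m"]) (auto simp: depends_on_def intro!: A(2))
qed

lemma depends_on_exchange:
  assumes "depends_on A f" "x \<notin> A" "y \<notin> A"
  shows "f (exchange \<eta> x y) = f \<eta>"
proof -
  have "\<forall>z\<in>A. exchange \<eta> x y z = \<eta> z" using assms(2,3) by (auto simp: exchange_def)
  then show ?thesis using assms(1) unfolding depends_on_def by blast
qed

text \<open>
  Sorting the jumps by the bond that they cross; only bonds that meet \<open>[-b,b]\<close> change \<open>f\<close>.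
\<close>

lemma exclusion_generator_eq_bond_sum:
  assumes f: "depends_on {-b..b} f" and b: "0 \<le> b"
  shows "exclusion_generator p f \<eta>
    = (\<Sum>x\<in>{-b-1..b}. bond_rate p \<eta> x * (f (bond_swap \<eta> x) - f \<eta>))"
proof -
  let ?R = "\<lambda>x. p * of_bool (\<eta> x) * (1 - of_bool (\<eta> (x + 1))) * (f (exchange \<eta> x (x + 1)) - f \<eta>)"
  let ?L = "\<lambda>x. (1 - p) * of_bool (\<eta> x) * (1 - of_bool (\<eta> (x - 1))) * (f (exchange \<eta> x (x - 1)) - f \<eta>)"
  have summand: "(\<Sum>y\<in>{x - 1, x + 1}.
        jump_rate p x y * of_bool (\<eta> x) * (1 - of_bool (\<eta> y)) * (f (exchange \<eta> x y) - f \<eta>)) = ?R x + ?L x" for x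
    by (simp add: jump_rate_def)
  have R0: "?R x = 0" if "x \<notin> {-b-1..b}" for x
    using depends_on_exchange[OF f, of x "x + 1" \<eta>] that by force
  have L0: "?L x = 0" if "x \<notin> {-b..b+1}" for x
    using depends_on_exchange[OF f, of x "x - 1" \<eta>] that by force
  \<comment> \<open>\<open>?R x\<close> crosses the bond to the right of \<open>x\<close> and \<open>?L x\<close> the bond to its left, hence the shift of \<open>?L\<close>\<close>
  have "exclusion_generator p f \<eta> = (\<Sum>\<^sub>\<infinity>x\<in>UNIV. ?R x + ?L x)"
    unfolding exclusion_generator_def summand ..
  also have "\<dots> = (\<Sum>\<^sub>\<infinity>x\<in>{-b-1..b+1}. ?R x + ?L x)"
  proof (rule infsum_cong_neutral)
    fix x assume "x \<in> UNIV - {-b-1..b+1}"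
    then show "?R x + ?L x = 0" using R0[of x] L0[of x] by auto
  qed auto
  also have "\<dots> = (\<Sum>x\<in>{-b-1..b+1}. ?R x) + (\<Sum>x\<in>{-b-1..b+1}. ?L x)"
    by (simp add: sum.distrib)
  also have "(\<Sum>x\<in>{-b-1..b+1}. ?R x) = (\<Sum>x\<in>{-b-1..b}. ?R x)"
    by (rule sum.mono_neutral_right[OF _ _ ballI[OF R0]]) auto
  also have "(\<Sum>x\<in>{-b-1..b+1}. ?L x) = (\<Sum>x\<in>{-b..b+1}. ?L x)"
    by (rule sum.mono_neutral_right[OF _ _ ballI[OF L0]]) auto
  also have "\<dots> = (\<Sum>x\<in>{-b-1..b}. ?L (x + 1))"
    by (rule sum.reindex_bij_witness[of _ "\<lambda>x. x + 1" "\<lambda>x. x - 1"]) auto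
  finally show ?thesis
    by (simp add: sum.distrib[symmetric] bond_rate_def exchange_commute[of _ "_ + 1"] algebra_simps)
qed

text \<open>
  Invariance of \<open>\<nu>\<^sub>\<alpha>\<close>. Moving the exchange from \<open>f\<close> to the rate leaves, for each bond, the
  rate after the exchange minus the rate before, which is \<open>2 p - 1\<close> times the discrete gradient
  \<open>\<eta>(x+1) - \<eta>(x)\<close>. The sum over bonds telescopes to two sites outside the support of \<open>f\<close>, and exchanging
  these two sites shows that their contributions cancel.
\<close>

lemma bernoulli_generator_integral:
  assumes p: "0 \<le> p" "p \<le> 1"
    and f: "f \<in> borel_measurable config_space" "\<And>\<eta>. \<bar>f \<eta>\<bar> \<le> C"
    and loc: "depends_on {-b..b} f" "0 \<le> b"
  shows "(\<integral>\<eta>. exclusion_generator p f \<eta> \<partial>bernoulli_measure \<alpha>) = 0"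
proof -
  let ?\<nu> = "bernoulli_measure \<alpha>"
  let ?o = "\<lambda>x \<eta>. of_bool (\<eta> x) :: real"
  have C: "0 \<le> C" using f(2)[of undefined] by linarith
  have int1: "integrable ?\<nu> (\<lambda>\<eta>. bond_rate p \<eta> x * f (exchange \<eta> y z))" for x y z
    using f by (intro bernoulli_integrable_mult[where C = 1 and D = C] bond_rate_abs_le p) auto
  have int2: "integrable ?\<nu> (\<lambda>\<eta>. bond_rate p \<eta> x * f \<eta>)" for x
    using f by (intro bernoulli_integrable_mult[where C = 1 and D = C] bond_rate_abs_le p) auto
  have int3: "integrable ?\<nu> (\<lambda>\<eta>. bond_rate p (exchange \<eta> y z) x * f \<eta>)" for x y z
    using f by (intro bernoulli_integrable_mult[where C = 1 and D = C] bond_rate_abs_le p) auto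
  have int4: "integrable ?\<nu> (\<lambda>\<eta>. ?o x \<eta> * f \<eta>)" for x
    using f by (intro bernoulli_integrable_mult[where C = 1 and D = C]) auto
  have "(\<integral>\<eta>. exclusion_generator p f \<eta> \<partial>?\<nu>)
      = (\<Sum>x\<in>{-b-1..b}. (\<integral>\<eta>. bond_rate p \<eta> x * f (bond_swap \<eta> x) \<partial>?\<nu>) - (\<integral>\<eta>. bond_rate p \<eta> x * f \<eta> \<partial>?\<nu>))"
    by (simp add: exclusion_generator_eq_bond_sum[OF loc] right_diff_distrib int1 int2)
  also have "\<dots> = (\<Sum>x\<in>{-b-1..b}. (\<integral>\<eta>. bond_rate p (bond_swap \<eta> x) x * f \<eta> \<partial>?\<nu>) - (\<integral>\<eta>. bond_rate p \<eta> x * f \<eta> \<partial>?\<nu>))"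
    by (intro sum.cong refl arg_cong2[where f = minus] integral_move_exchange f bond_rate_measurable)
  also have "\<dots> = (\<Sum>x\<in>{-b-1..b}. (\<integral>\<eta>. (2 * p - 1) * (?o (x + 1) \<eta> * f \<eta> - ?o x \<eta> * f \<eta>) \<partial>?\<nu>))"
    by (intro sum.cong refl, subst Bochner_Integration.integral_diff[symmetric, OF int3 int2])
       (auto intro!: Bochner_Integration.integral_cong simp: bond_rate_def exchange_def algebra_simps)
  also have "\<dots> = (2 * p - 1) * (\<Sum>x\<in>{-b-1..b}. (\<integral>\<eta>. ?o (x + 1) \<eta> * f \<eta> \<partial>?\<nu>) - (\<integral>\<eta>. ?o x \<eta> * f \<eta> \<partial>?\<nu>))"
    by (simp add: int4 sum_distrib_left)
  also have "(\<Sum>x\<in>{-b-1..b}. (\<integral>\<eta>. ?o (x + 1) \<eta> * f \<eta> \<partial>?\<nu>) - (\<integral>\<eta>. ?o x \<eta> * f \<eta> \<partial>?\<nu>))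
     = (\<integral>\<eta>. ?o (b + 1) \<eta> * f \<eta> \<partial>?\<nu>) - (\<integral>\<eta>. ?o (-b-1) \<eta> * f \<eta> \<partial>?\<nu>)"
  proof -
    have tele: "(\<Sum>x\<in>{-b-1..-b-1+int n}. g (x + 1) - g x) = g (-b+int n) - g (-b-1)" for g :: "int \<Rightarrow> real" and n
    proof (induction n)
      case (Suc n)
      have "{-b-1..-b-1+int (Suc n)} = insert (-b-1+int (Suc n)) {-b-1..-b-1+int n}" by auto
      then show ?case using Suc by (simp add: algebra_simps)
    qed simp
    show ?thesis using tele[of "\<lambda>x. \<integral>\<eta>. ?o x \<eta> * f \<eta> \<partial>?\<nu>" "nat (2 * b + 1)"] loc(2)
      by (simp add: algebra_simps)
  qed
  \<comment> \<open>both sites lie outside \<open>[-b,b]\<close>, so exchanging them leaves \<open>f\<close> unchanged\<close>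
  also have "\<dots> = 0"
  proof -
    have "(\<integral>\<eta>. ?o (b + 1) \<eta> * f (exchange \<eta> (b + 1) (-b-1)) \<partial>?\<nu>)
        = (\<integral>\<eta>. ?o (b + 1) (exchange \<eta> (b + 1) (-b-1)) * f \<eta> \<partial>?\<nu>)"
      by (rule integral_move_exchange[OF f(1)]) simp
    moreover have "f (exchange \<eta> (b + 1) (-b-1)) = f \<eta>" for \<eta>
      by (rule depends_on_exchange[OF loc(1)]) auto
    ultimately show ?thesis using loc(2) by (simp add: exchange_def)
  qed
  finally show ?thesis by simp
qed

text \<open>
  The identity \<open>L f\<^sup>2 = 2 f L f + \<Sum>\<^sub>x r\<^sub>x (f(\<eta>\<^bsup>x,x+1\<^esup>) - f(\<eta>))\<^sup>2\<close>, with \<open>r\<^sub>x\<close> the rate of the bond, reduces the claim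
  to invariance. The squared difference is unchanged by the exchange and vanishes if the two values
  agree; otherwise the rates before and after the exchange add up to \<open>1\<close>. So each rate may be replaced
  by \<open>1/2\<close>, whatever the asymmetry.
\<close>

lemma bernoulli_dirichlet_form:
  assumes p: "0 \<le> p" "p \<le> 1"
    and f: "f \<in> borel_measurable config_space" "\<And>\<eta>. \<bar>f \<eta>\<bar> \<le> C"
    and loc: "depends_on {-b..b} f" "0 \<le> b"
  shows "- (\<integral>\<eta>. f \<eta> * exclusion_generator p f \<eta> \<partial>bernoulli_measure \<alpha>)
    = (\<Sum>x\<in>{-b-1..b}. (\<integral>\<eta>. (f (bond_swap \<eta> x) - f \<eta>)\<^sup>2 \<partial>bernoulli_measure \<alpha>)) / 4"
proof -
  let ?\<nu> = "bernoulli_measure \<alpha>"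
  let ?d = "\<lambda>x \<eta>. (f (bond_swap \<eta> x) - f \<eta>)\<^sup>2"
  have C: "0 \<le> C" using f(2)[of undefined] by linarith
  have d_meas [measurable]: "?d x \<in> borel_measurable config_space" for x
    using f(1) by measurable
  have d_le: "\<bar>?d x \<eta>\<bar> \<le> (2 * C)\<^sup>2" for x \<eta>
  proof -
    have "\<bar>f (bond_swap \<eta> x) - f \<eta>\<bar> \<le> 2 * C" using f(2)[of \<eta>] f(2)[of "bond_swap \<eta> x"] by linarith
    then show ?thesis using power_mono[of "\<bar>f (bond_swap \<eta> x) - f \<eta>\<bar>" "2 * C" 2] by simp
  qed
  have int_d: "integrable ?\<nu> (\<lambda>\<eta>. bond_rate p \<eta> x * ?d x \<eta>)"
    "integrable ?\<nu> (\<lambda>\<eta>. bond_rate p (bond_swap \<eta> x) x * ?d x \<eta>)" "integrable ?\<nu> (?d x)" for x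
    using d_le by (intro bernoulli_integrable_mult[where C = 1 and D = "(2 * C)\<^sup>2"]
        bernoulli_integrable_bounded[where C = "(2 * C)\<^sup>2"] bond_rate_abs_le p; simp)+
  have int_fL: "integrable ?\<nu> (\<lambda>\<eta>. f \<eta> * exclusion_generator p f \<eta>)"
  proof -
    have "integrable ?\<nu> (\<lambda>\<eta>. f \<eta> * (bond_rate p \<eta> x * (f (bond_swap \<eta> x) - f \<eta>)))" for x
    proof (rule bernoulli_integrable_mult[where C = C and D = "1 * (C + C)"])
      show "\<bar>bond_rate p \<eta> x * (f (bond_swap \<eta> x) - f \<eta>)\<bar> \<le> 1 * (C + C)" for \<eta>
        using f(2)[of \<eta>] f(2)[of "bond_swap \<eta> x"] by (intro abs_mult_le bond_rate_abs_le p) linarith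
    qed (use f in auto)
    then show ?thesis
      unfolding exclusion_generator_eq_bond_sum[OF loc] sum_distrib_left by (rule Bochner_Integration.integrable_sum)
  qed
  have half: "(\<integral>\<eta>. bond_rate p \<eta> x * ?d x \<eta> \<partial>?\<nu>) = (\<integral>\<eta>. ?d x \<eta> \<partial>?\<nu>) / 2" for x
  proof -
    have "(\<integral>\<eta>. bond_rate p \<eta> x * ?d x \<eta> \<partial>?\<nu>) = (\<integral>\<eta>. bond_rate p (bond_swap \<eta> x) x * ?d x \<eta> \<partial>?\<nu>)"
      using integral_move_exchange[OF d_meas[of x] bond_rate_measurable[of p x], where \<alpha> = \<alpha> and x = x and y = "x + 1"]
      by (simp add: power2_commute)
    moreover have "(\<integral>\<eta>. bond_rate p \<eta> x * ?d x \<eta> \<partial>?\<nu>) + (\<integral>\<eta>. bond_rate p (bond_swap \<eta> x) x * ?d x \<eta> \<partial>?\<nu>)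
        = (\<integral>\<eta>. ?d x \<eta> \<partial>?\<nu>)"
    proof (subst Bochner_Integration.integral_add[symmetric, OF int_d(1,2)],
        rule Bochner_Integration.integral_cong[OF refl])
      fix \<eta>
      show "bond_rate p \<eta> x * ?d x \<eta> + bond_rate p (bond_swap \<eta> x) x * ?d x \<eta> = ?d x \<eta>"
      proof (cases "\<eta> x = \<eta> (x + 1)")
        case True
        then have "bond_swap \<eta> x = \<eta>" by (auto simp: exchange_def fun_eq_iff)
        then show ?thesis by simp
      next
        case False
        then show ?thesis by (auto simp: bond_rate_def exchange_def algebra_simps)
      qed
    qed
    ultimately show ?thesis by simp
  qed
  have f2: "(\<lambda>\<eta>. (f \<eta>)\<^sup>2) \<in> borel_measurable config_space" using f(1) by measurable
  have f2_le: "\<bar>(f \<eta>)\<^sup>2\<bar> \<le> C\<^sup>2" for \<eta>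
    using power_mono[OF f(2)[of \<eta>], where n = 2] by simp
  have loc2: "depends_on {-b..b} (\<lambda>\<eta>. (f \<eta>)\<^sup>2)"
    unfolding depends_on_def
  proof (intro allI impI)
    fix \<eta> \<zeta> :: config assume "\<forall>x\<in>{-b..b}. \<eta> x = \<zeta> x"
    then have "f \<eta> = f \<zeta>" using loc(1) unfolding depends_on_def by blast
    then show "(f \<eta>)\<^sup>2 = (f \<zeta>)\<^sup>2" by simp
  qed
  have carre: "exclusion_generator p (\<lambda>\<eta>. (f \<eta>)\<^sup>2) \<eta>
      = 2 * (f \<eta> * exclusion_generator p f \<eta>) + (\<Sum>x\<in>{-b-1..b}. bond_rate p \<eta> x * ?d x \<eta>)" for \<eta>
    unfolding exclusion_generator_eq_bond_sum[OF loc] exclusion_generator_eq_bond_sum[OF loc2 loc(2)]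
      sum_distrib_left sum.distrib[symmetric]
    by (intro sum.cong refl) (simp add: power2_eq_square algebra_simps)
  have "0 = (\<integral>\<eta>. exclusion_generator p (\<lambda>\<eta>. (f \<eta>)\<^sup>2) \<eta> \<partial>?\<nu>)"
    by (rule bernoulli_generator_integral[OF p f2 f2_le loc2 loc(2), symmetric])
  also have "\<dots> = 2 * (\<integral>\<eta>. f \<eta> * exclusion_generator p f \<eta> \<partial>?\<nu>) + (\<Sum>x\<in>{-b-1..b}. (\<integral>\<eta>. ?d x \<eta> \<partial>?\<nu>) / 2)"
    unfolding carre by (simp add: int_d int_fL half)
  finally show ?thesis by (simp add: sum_divide_distrib[symmetric])
qed

text \<open>
  The generator is the closure of its restriction to local functions, so a closed property of pairs
  \<open>(f, L f)\<close> has to be checked for local \<open>f\<close> only.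
\<close>

lemma generator_graph_closed_induct:
  assumes S: "asep_semigroup p S" and fg: "(f, g) \<in> generator_graph S"
    and closed: "closed {(f, g). P f g}"
    and local: "\<And>f g b. 0 \<le> b \<Longrightarrow> depends_on {-b..b} (apply_bcontfun f) \<Longrightarrow>
      apply_bcontfun g = exclusion_generator p (apply_bcontfun f) \<Longrightarrow> P f g"
  shows "P f g"
proof -
  have "{(f, g). local_function (apply_bcontfun f) \<and>
            apply_bcontfun g = exclusion_generator p (apply_bcontfun f)} \<subseteq> {(f, g). P f g}"
  proof clarify
    fix f g assume f: "local_function (apply_bcontfun f)"
      and g: "apply_bcontfun g = exclusion_generator p (apply_bcontfun f)"
    from f obtain b where "0 \<le> b" "depends_on {-b..b} (apply_bcontfun f)"
      by (rule local_function_depends_on)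
    then show "P f g" using g by (rule local)
  qed
  then have "generator_graph S \<subseteq> {(f, g). P f g}"
    using S closed unfolding asep_semigroup_def by (metis (no_types, lifting) closure_minimal)
  then show ?thesis using fg by blast
qed

lemma generator_graph_invariant:
  assumes p: "0 \<le> p" "p \<le> 1" and S: "asep_semigroup p S" and fg: "(f, g) \<in> generator_graph S"
  shows "(\<integral>\<eta>. apply_bcontfun g \<eta> \<partial>bernoulli_measure \<alpha>) = 0"
proof (rule generator_graph_closed_induct[OF S fg])
  let ?\<nu> = "bernoulli_measure \<alpha>"
  have eq: "(\<integral>\<eta>. apply_bcontfun g \<eta> \<partial>?\<nu>) = bcontfun_inner ?\<nu> (const_bcontfun 1) g" for g
    by (simp add: bcontfun_inner_def)
  show "closed {(f :: config \<Rightarrow>\<^sub>C real, g :: config \<Rightarrow>\<^sub>C real). (\<integral>\<eta>. apply_bcontfun g \<eta> \<partial>?\<nu>) = 0}"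
    unfolding eq case_prod_unfold
    by (intro closed_Collect_eq continuous_intros
      bounded_bilinear.continuous_on[OF bounded_bilinear_bcontfun_inner[OF prob_space_bernoulli_measure bernoulli_sets_borel]])
next
  fix f g :: "config \<Rightarrow>\<^sub>C real" and b
  assume "0 \<le> b" "depends_on {-b..b} (apply_bcontfun f)"
    and "apply_bcontfun g = exclusion_generator p (apply_bcontfun f)"
  then show "(\<integral>\<eta>. apply_bcontfun g \<eta> \<partial>bernoulli_measure \<alpha>) = 0"
    using bernoulli_generator_integral[OF p bcontfun_config_measurable apply_bcontfun_abs_le] by simp
qed

lemma asep_process_stationary_markov:
  assumes p: "0 \<le> p" "p \<le> 1" and X: "asep_process p (bernoulli_measure \<alpha>) M X"
  obtains S where "asep_semigroup p S" "stationary_markov_process M X S (bernoulli_measure \<alpha>)"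
proof -
  obtain S where S: "asep_semigroup p S"
    and markov: "\<And>s t f. 0 \<le> s \<Longrightarrow> 0 \<le> t \<Longrightarrow>
      AE \<omega> in M. real_cond_exp M (natural_filtration M X s) (\<lambda>\<omega>. apply_bcontfun f (X (s + t) \<omega>)) \<omega>
             = apply_bcontfun (S t f) (X s \<omega>)"
    using X unfolding asep_process_def by blast
  have "stationary_markov_process M X S (bernoulli_measure \<alpha>)"
  proof (intro stationary_markov_process.intro stationary_markov_process_axioms.intro)
    show "prob_space M" using X by (simp add: asep_process_def)
    show "markov_semigroup S" using S by (simp add: asep_semigroup_def)
  qed (use X markov generator_graph_invariant[OF p S] in \<open>auto simp: asep_process_def\<close>)
  then show ?thesis using that S by blast
qed

section \<open>Replacing a neighbour by a block average\<close>

definition block_gradient :: "real \<Rightarrow> (int \<Rightarrow> real) \<Rightarrow> int set \<Rightarrow> nat \<Rightarrow> config \<Rightarrow> real" where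
  "block_gradient \<alpha> h A K \<eta> = (\<Sum>x\<in>A. h x * centered \<alpha> \<eta> x *
     (centered \<alpha> \<eta> (x + 1) - (\<Sum>j=1..K. centered \<alpha> \<eta> (x + int j)) / K))"

definition block_average :: "real \<Rightarrow> (int \<Rightarrow> real) \<Rightarrow> int set \<Rightarrow> nat \<Rightarrow> config \<Rightarrow> real" where
  "block_average \<alpha> h A K \<eta> = (\<Sum>x\<in>A. h x * centered \<alpha> \<eta> x * ((\<Sum>j=1..K. centered \<alpha> \<eta> (x + int j)) / K))"

text \<open>
  The coefficient of the gradient at the bond from \<open>y\<close> to \<open>y + 1\<close>. It collects the sites \<open>y - i\<close> whose block
  reaches across this bond; \<open>1 - i / K\<close> is the share of the block that lies beyond it.
\<close>

definition block_weight :: "real \<Rightarrow> (int \<Rightarrow> real) \<Rightarrow> int set \<Rightarrow> nat \<Rightarrow> int \<Rightarrow> config \<Rightarrow> real" where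
  "block_weight \<alpha> h A K y \<eta> = (\<Sum>i=1..<K. (1 - i / K) * (h (y - int i) * of_bool (y - int i \<in> A)) * centered \<alpha> \<eta> (y - int i))"

lemma sum_minus_average:
  fixes a :: "nat \<Rightarrow> real"
  assumes "0 < K"
  shows "a 1 - (\<Sum>j=1..K. a j) / K = (\<Sum>i=1..<K. (1 - i / K) * (a i - a (Suc i)))"
proof -
  have "(\<Sum>i=1..<k. (real K - i) * (a i - a (Suc i))) = K * a 1 - (\<Sum>j=1..k. a j) - (real K - k) * a k" 
    if "1 \<le> k" for k
    using that
  proof (induction k rule: dec_induct)
    case (step k)
    then show ?case by (simp add: algebra_simps)
  qed (simp add: algebra_simps)
  from this[of K] have "(\<Sum>i=1..<K. (real K - i) * (a i - a (Suc i))) = K * a 1 - (\<Sum>j=1..K. a j)"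
    using assms by simp
  then have "a 1 - (\<Sum>j=1..K. a j) / K = (\<Sum>i=1..<K. (real K - i) * (a i - a (Suc i))) / K"
    using assms by (simp add: field_simps)
  also have "\<dots> = (\<Sum>i=1..<K. (1 - i / K) * (a i - a (Suc i)))"
    unfolding sum_divide_distrib using assms by (intro sum.cong) (auto simp: field_simps)
  finally show ?thesis .
qed

text \<open>
  The difference between the neighbour and the average telescopes along the block. Regrouping by bonds
  matters: estimated one by one, the terms would use the gradient of the test function at every bond
  about \<open>K\<close> times, and the resulting bound would be larger by a factor \<open>K\<close>.
\<close>

lemma block_gradient_eq_sum_bonds:
  assumes K: "0 < K" and Y: "finite Y" "\<And>x i. x \<in> A \<Longrightarrow> 1 \<le> i \<Longrightarrow> i < K \<Longrightarrow> x + int i \<in> Y" and A: "finite A"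
  shows "block_gradient \<alpha> h A K \<eta>
    = (\<Sum>y\<in>Y. block_weight \<alpha> h A K y \<eta> * (centered \<alpha> \<eta> y - centered \<alpha> \<eta> (y + 1)))"
proof -
  let ?c = "centered \<alpha> \<eta>"
  have "block_gradient \<alpha> h A K \<eta> = (\<Sum>x\<in>A. \<Sum>i=1..<K. (1 - i / K) * h x * ?c x * (?c (x + int i) - ?c (x + int i + 1)))"
    unfolding block_gradient_def
  proof (rule sum.cong[OF refl])
    fix x
    show "h x * ?c x * (?c (x + 1) - (\<Sum>j=1..K. ?c (x + int j)) / K)
       = (\<Sum>i=1..<K. (1 - i / K) * h x * ?c x * (?c (x + int i) - ?c (x + int i + 1)))"
      using sum_minus_average[OF K, of "\<lambda>j. ?c (x + int j)"]
      by (simp add: sum_distrib_left algebra_simps)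
  qed
  also have "\<dots> = (\<Sum>i=1..<K. \<Sum>x\<in>A. (1 - i / K) * h x * ?c x * (?c (x + int i) - ?c (x + int i + 1)))"
    by (rule sum.swap)
  also have "\<dots> = (\<Sum>i=1..<K. \<Sum>y\<in>Y. (1 - i / K) * (h (y - int i) * of_bool (y - int i \<in> A)) * ?c (y - int i) * (?c y - ?c (y + 1)))"
  proof (rule sum.cong[OF refl])
    fix i assume i: "i \<in> {1..<K}"
    let ?g = "\<lambda>y. (1 - i / K) * (h (y - int i) * of_bool (y - int i \<in> A)) * ?c (y - int i) * (?c y - ?c (y + 1))"
    have "(\<Sum>x\<in>A. (1 - i / K) * h x * ?c x * (?c (x + int i) - ?c (x + int i + 1))) = (\<Sum>y\<in>(\<lambda>x. x + int i) ` A. ?g y)"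
      by (subst sum.reindex) (auto simp: inj_on_def)
    also have "\<dots> = (\<Sum>y\<in>Y. ?g y)"
      by (rule sum.mono_neutral_left) (use Y i in \<open>auto simp: image_iff, force\<close>)
    finally show "(\<Sum>x\<in>A. (1 - i / K) * h x * ?c x * (?c (x + int i) - ?c (x + int i + 1))) = (\<Sum>y\<in>Y. ?g y)" .
  qed
  also have "\<dots> = (\<Sum>y\<in>Y. \<Sum>i=1..<K. (1 - i / K) * (h (y - int i) * of_bool (y - int i \<in> A)) * ?c (y - int i) * (?c y - ?c (y + 1)))"
    by (rule sum.swap)
  finally show ?thesis by (simp add: block_weight_def sum_distrib_right)
qed

lemma block_weight_second_moment:
  assumes \<alpha>: "0 \<le> \<alpha>" "\<alpha> \<le> 1"
  shows "(\<integral>\<eta>. (block_weight \<alpha> h A K y \<eta>)\<^sup>2 \<partial>bernoulli_measure \<alpha>)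
    \<le> (\<Sum>i=1..<K. (h (y - int i))\<^sup>2 * of_bool (y - int i \<in> A))"
proof -
  let ?c = "\<lambda>i. (1 - i / K) * (h (y - int i) * of_bool (y - int i \<in> A))"
  have "(\<integral>\<eta>. (block_weight \<alpha> h A K y \<eta>)\<^sup>2 \<partial>bernoulli_measure \<alpha>) \<le> (\<Sum>i=1..<K. (?c i)\<^sup>2)"
    unfolding block_weight_def
  proof (rule bernoulli_integral_sum_square_le)
    fix i j :: nat assume "i \<noteq> j"
    then show "(\<integral>\<eta>. centered \<alpha> \<eta> (y - int i) * centered \<alpha> \<eta> (y - int j) \<partial>bernoulli_measure \<alpha>) = 0"
      using centered_abs_le[OF \<alpha>]
      by (intro bernoulli_integral_centered_mult[where C = 1] \<alpha>) (auto simp: centered_def)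
  qed (use centered_abs_le[OF \<alpha>] in auto)
  also have "\<dots> \<le> (\<Sum>i=1..<K. (h (y - int i))\<^sup>2 * of_bool (y - int i \<in> A))"
  proof (rule sum_mono)
    fix i assume i: "i \<in> {1..<K}"
    then have "(1 - real i / K)\<^sup>2 \<le> 1" by (intro power_le_one) (auto simp: field_simps)
    then show "(?c i)\<^sup>2 \<le> (h (y - int i))\<^sup>2 * of_bool (y - int i \<in> A)"
      by (auto simp: power_mult_distrib intro!: mult_left_le_one_le)
  qed
  finally show ?thesis .
qed

text \<open>
  All sites \<open>y - i\<close> in the weight have \<open>i \<ge> 1\<close> and so differ from \<open>y\<close> and \<open>y + 1\<close>.
\<close>

lemma block_weight_exchange [simp]:
  "block_weight \<alpha> h A K y (bond_swap \<eta> y) = block_weight \<alpha> h A K y \<eta>"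
  unfolding block_weight_def by (intro sum.cong refl) (auto simp: centered_def exchange_def)

lemma block_weight_measurable [measurable]: "block_weight \<alpha> h A K y \<in> borel_measurable config_space"
  unfolding block_weight_def by measurable

lemma block_weight_bounded:
  assumes "0 \<le> \<alpha>" "\<alpha> \<le> 1"
  shows "\<bar>block_weight \<alpha> h A K y \<eta>\<bar> \<le> (\<Sum>i=1..<K. \<bar>(1 - i / K) * (h (y - int i) * of_bool (y - int i \<in> A))\<bar>)"
  unfolding block_weight_def
proof (rule order_trans[OF sum_abs sum_mono])
  fix i
  show "\<bar>(1 - real i / K) * (h (y - int i) * of_bool (y - int i \<in> A)) * centered \<alpha> \<eta> (y - int i)\<bar>
      \<le> \<bar>(1 - real i / K) * (h (y - int i) * of_bool (y - int i \<in> A))\<bar>"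
    unfolding abs_mult[of _ "centered _ _ _"] using centered_abs_le[OF assms] by (intro mult_left_le) auto
qed

text \<open>
  Integration by parts for the exchange at a bond: the gradient changes sign and the weight does not,
  so twice the pairing with \<open>f\<close> is the pairing with \<open>f(\<eta>) - f(\<eta>\<^bsup>y,y+1\<^esup>)\<close>. The inequality of the
  arithmetic and geometric means then separates the weight from the change of \<open>f\<close>.
\<close>

lemma block_gradient_dirichlet_bound:
  assumes \<alpha>: "0 \<le> \<alpha>" "\<alpha> \<le> 1" and K: "0 < K" and A: "finite A" and Y: "finite Y"
    and sub: "\<And>x i. x \<in> A \<Longrightarrow> 1 \<le> i \<Longrightarrow> i < K \<Longrightarrow> x + int i \<in> Y"
    and f: "f \<in> borel_measurable config_space" "\<And>\<eta>. \<bar>f \<eta>\<bar> \<le> C"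
  shows "2 * (\<integral>\<eta>. block_gradient \<alpha> h A K \<eta> * f \<eta> \<partial>bernoulli_measure \<alpha>)
    \<le> K * (\<Sum>x\<in>A. (h x)\<^sup>2) + (\<Sum>y\<in>Y. (\<integral>\<eta>. (f (bond_swap \<eta> y) - f \<eta>)\<^sup>2 \<partial>bernoulli_measure \<alpha>)) / 4"
proof -
  let ?\<nu> = "bernoulli_measure \<alpha>"
  let ?F = "block_weight \<alpha> h A K" and ?c = "centered \<alpha>"
  let ?D = "\<lambda>y. \<integral>\<eta>. (f (bond_swap \<eta> y) - f \<eta>)\<^sup>2 \<partial>?\<nu>"
  define b where "b y = (\<Sum>i=1..<K. \<bar>(1 - i / K) * (h (y - int i) * of_bool (y - int i \<in> A))\<bar>)" for y
  have F_le: "\<bar>?F y \<eta>\<bar> \<le> b y" for y \<eta> unfolding b_def by (rule block_weight_bounded[OF \<alpha>])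
  have g_le: "\<bar>?c \<eta> y - ?c \<eta> (y + 1)\<bar> \<le> 1" for y \<eta> by (auto simp: centered_def)
  have Fg_le: "\<bar>?F y \<eta> * (?c \<eta> y - ?c \<eta> (y + 1))\<bar> \<le> b y * 1" for y \<eta>
    by (intro abs_mult_le F_le g_le)
  have d_le: "\<bar>f \<eta> - f (bond_swap \<eta> y)\<bar> \<le> C + C" for y \<eta>
    using f(2)[of \<eta>] f(2)[of "bond_swap \<eta> y"] by linarith
  have [measurable]: "f \<in> borel_measurable config_space" by fact
  have bond: "2 * (\<integral>\<eta>. ?F y \<eta> * (?c \<eta> y - ?c \<eta> (y + 1)) * f \<eta> \<partial>?\<nu>)
      \<le> (\<integral>\<eta>. (?F y \<eta>)\<^sup>2 \<partial>?\<nu>) + ?D y / 4" for y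
  proof -
    have "(\<integral>\<eta>. ?F y \<eta> * (?c \<eta> y - ?c \<eta> (y + 1)) * f (bond_swap \<eta> y) \<partial>?\<nu>)
        = (\<integral>\<eta>. - (?F y \<eta> * (?c \<eta> y - ?c \<eta> (y + 1)) * f \<eta>) \<partial>?\<nu>)"
    proof (subst integral_move_exchange)
      show "(\<integral>\<eta>. ?F y (bond_swap \<eta> y) * (?c (bond_swap \<eta> y) y - ?c (bond_swap \<eta> y) (y + 1)) * f \<eta> \<partial>?\<nu>)
        = (\<integral>\<eta>. - (?F y \<eta> * (?c \<eta> y - ?c \<eta> (y + 1)) * f \<eta>) \<partial>?\<nu>)"
        by (intro Bochner_Integration.integral_cong refl) (simp only: block_weight_exchange centered_exchange, simp add: algebra_simps)
    qed measurable
    moreover have "(\<integral>\<eta>. ?F y \<eta> * (?c \<eta> y - ?c \<eta> (y + 1)) * (f \<eta> - f (bond_swap \<eta> y)) \<partial>?\<nu>)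
        = (\<integral>\<eta>. ?F y \<eta> * (?c \<eta> y - ?c \<eta> (y + 1)) * f \<eta> \<partial>?\<nu>)
          - (\<integral>\<eta>. ?F y \<eta> * (?c \<eta> y - ?c \<eta> (y + 1)) * f (bond_swap \<eta> y) \<partial>?\<nu>)"
      unfolding right_diff_distrib[of "_ * _"]
      by (intro Bochner_Integration.integral_diff
          bernoulli_integrable_mult[where C = "b y * 1" and D = C] Fg_le f) measurable
    ultimately have "2 * (\<integral>\<eta>. ?F y \<eta> * (?c \<eta> y - ?c \<eta> (y + 1)) * f \<eta> \<partial>?\<nu>)
      = (\<integral>\<eta>. ?F y \<eta> * (?c \<eta> y - ?c \<eta> (y + 1)) * (f \<eta> - f (bond_swap \<eta> y)) \<partial>?\<nu>)" by simp
    also have "\<dots> \<le> (\<integral>\<eta>. ?F y \<eta> * ?F y \<eta> + (f \<eta> - f (bond_swap \<eta> y)) * (f \<eta> - f (bond_swap \<eta> y)) / 4 \<partial>?\<nu>)"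
    proof (rule integral_mono)
      show "integrable ?\<nu> (\<lambda>\<eta>. ?F y \<eta> * (?c \<eta> y - ?c \<eta> (y + 1)) * (f \<eta> - f (bond_swap \<eta> y)))"
        by (intro bernoulli_integrable_mult[where C = "b y * 1" and D = "C + C"] Fg_le d_le) measurable
      show "integrable ?\<nu> (\<lambda>\<eta>. ?F y \<eta> * ?F y \<eta> + (f \<eta> - f (bond_swap \<eta> y)) * (f \<eta> - f (bond_swap \<eta> y)) / 4)"
        by (intro Bochner_Integration.integrable_add Bochner_Integration.integrable_divide
           bernoulli_integrable_mult[where C = "b y" and D = "b y"]
           bernoulli_integrable_mult[where C = "C + C" and D = "C + C"] F_le d_le) measurable
      fix \<eta>
      let ?u = "?F y \<eta>" and ?v = "?c \<eta> y - ?c \<eta> (y + 1)" and ?w = "f \<eta> - f (bond_swap \<eta> y)"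
      have "(?u * ?v)\<^sup>2 \<le> ?u\<^sup>2"
        unfolding power_mult_distrib using power_mono[OF g_le[where y = y and \<eta> = \<eta>], where n = 2] by (intro mult_left_le) auto
      moreover have "0 \<le> (?u * ?v - ?w / 2)\<^sup>2" by simp
      ultimately show "?u * ?v * ?w \<le> ?u * ?u + ?w * ?w / 4"
        by (simp add: power2_eq_square algebra_simps)
    qed
    also have "\<dots> = (\<integral>\<eta>. (?F y \<eta>)\<^sup>2 \<partial>?\<nu>) + ?D y / 4"
    proof (subst Bochner_Integration.integral_add)
      show "integrable ?\<nu> (\<lambda>\<eta>. ?F y \<eta> * ?F y \<eta>)"
        by (intro bernoulli_integrable_mult[where C = "b y" and D = "b y"] F_le) measurable
      show "integrable ?\<nu> (\<lambda>\<eta>. (f \<eta> - f (bond_swap \<eta> y)) * (f \<eta> - f (bond_swap \<eta> y)) / 4)"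
        by (intro Bochner_Integration.integrable_divide
           bernoulli_integrable_mult[where C = "C + C" and D = "C + C"] d_le) measurable
    qed (simp add: power2_eq_square[symmetric] power2_commute)
    finally show ?thesis .
  qed
  have bonds: "block_gradient \<alpha> h A K \<eta> * f \<eta> = (\<Sum>y\<in>Y. ?F y \<eta> * (?c \<eta> y - ?c \<eta> (y + 1)) * f \<eta>)" for \<eta>
    using block_gradient_eq_sum_bonds[OF K Y sub A, where \<alpha> = \<alpha> and h = h and \<eta> = \<eta>]
    by (simp add: sum_distrib_right)
  have int: "integrable ?\<nu> (\<lambda>\<eta>. ?F y \<eta> * (?c \<eta> y - ?c \<eta> (y + 1)) * f \<eta>)" for y
    by (intro bernoulli_integrable_mult[where C = "b y * 1" and D = C] Fg_le f) measurable
  have "2 * (\<integral>\<eta>. block_gradient \<alpha> h A K \<eta> * f \<eta> \<partial>?\<nu>)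
      = (\<Sum>y\<in>Y. 2 * (\<integral>\<eta>. ?F y \<eta> * (?c \<eta> y - ?c \<eta> (y + 1)) * f \<eta> \<partial>?\<nu>))"
    unfolding bonds Bochner_Integration.integral_sum[OF int] sum_distrib_left ..
  also have "\<dots> \<le> (\<Sum>y\<in>Y. (\<Sum>i=1..<K. (h (y - int i))\<^sup>2 * of_bool (y - int i \<in> A)) + ?D y / 4)"
    by (intro sum_mono order_trans[OF bond] add_right_mono block_weight_second_moment \<alpha>)
  also have "\<dots> = (\<Sum>i=1..<K. \<Sum>y\<in>Y. (h (y - int i))\<^sup>2 * of_bool (y - int i \<in> A)) + (\<Sum>y\<in>Y. ?D y) / 4"
    by (simp add: sum.distrib sum_divide_distrib sum.swap[of _ Y])
  also have "(\<Sum>i=1..<K. \<Sum>y\<in>Y. (h (y - int i))\<^sup>2 * of_bool (y - int i \<in> A)) \<le> (\<Sum>i=1..<K. \<Sum>x\<in>A. (h x)\<^sup>2)"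
  proof (rule sum_mono)
    fix i assume i: "i \<in> {1..<K}"
    have "(\<Sum>y\<in>Y. (h (y - int i))\<^sup>2 * of_bool (y - int i \<in> A)) = (\<Sum>y\<in>{y\<in>Y. y - int i \<in> A}. (h (y - int i))\<^sup>2)"
      unfolding sum.inter_filter[OF Y] by (rule sum.cong) auto
    also have "\<dots> = (\<Sum>x\<in>(\<lambda>y. y - int i) ` {y\<in>Y. y - int i \<in> A}. (h x)\<^sup>2)"
      by (subst sum.reindex) (auto simp: inj_on_def)
    also have "\<dots> \<le> (\<Sum>x\<in>A. (h x)\<^sup>2)"
      using A by (intro sum_mono2) auto
    finally show "(\<Sum>y\<in>Y. (h (y - int i))\<^sup>2 * of_bool (y - int i \<in> A)) \<le> (\<Sum>x\<in>A. (h x)\<^sup>2)" .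
  qed
  also have "(\<Sum>i=1..<K. \<Sum>x\<in>A. (h x)\<^sup>2) \<le> K * (\<Sum>x\<in>A. (h x)\<^sup>2)"
    by (simp add: mult_right_mono sum_nonneg)
  finally show ?thesis by simp
qed

lemma centered_bcontfun: "(\<lambda>\<eta>. centered \<alpha> \<eta> x) \<in> bcontfun"
proof (rule bcontfun_normI)
  have "continuous_on UNIV (\<lambda>u :: bool. of_bool u - \<alpha>)"
    by (auto simp: continuous_on_open_vimage Topological_Spaces.open_discrete)
  from continuous_on_compose2[OF this continuous_on_product_coordinates]
  show "continuous_on UNIV (\<lambda>\<eta>. centered \<alpha> \<eta> x)"
    by (simp add: centered_def)
  show "norm (centered \<alpha> \<eta> x) \<le> 1 + \<bar>\<alpha>\<bar>" for \<eta>
    by (auto simp: centered_def)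
qed

lemma block_gradient_bcontfun: "block_gradient \<alpha> h A K \<in> bcontfun"
  unfolding block_gradient_def divide_inverse
  by (intro bcontfun_sum bcontfun_mult minus_cont const_bcontfun centered_bcontfun)

lemma block_average_bcontfun: "block_average \<alpha> h A K \<in> bcontfun"
  unfolding block_average_def divide_inverse
  by (intro bcontfun_sum bcontfun_mult minus_cont const_bcontfun centered_bcontfun)

lemma generator_graph_block_gradient_bound:
  assumes p: "0 \<le> p" "p \<le> 1" and \<alpha>: "0 \<le> \<alpha>" "\<alpha> \<le> 1" and S: "asep_semigroup p S"
    and K: "0 < K" and A: "finite A" and fg: "(f, g) \<in> generator_graph S"
  shows "2 * bcontfun_inner (bernoulli_measure \<alpha>) (Bcontfun (block_gradient \<alpha> h A K)) f
    \<le> K * (\<Sum>x\<in>A. (h x)\<^sup>2) - bcontfun_inner (bernoulli_measure \<alpha>) f g"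
proof (rule generator_graph_closed_induct[OF S fg])
  show "closed {(f, g). 2 * bcontfun_inner (bernoulli_measure \<alpha>) (Bcontfun (block_gradient \<alpha> h A K)) f
    \<le> K * (\<Sum>x\<in>A. (h x)\<^sup>2) - bcontfun_inner (bernoulli_measure \<alpha>) f g}"
    unfolding case_prod_unfold
    by (intro closed_Collect_le continuous_intros
      bounded_bilinear.continuous_on[OF bounded_bilinear_bcontfun_inner[OF prob_space_bernoulli_measure bernoulli_sets_borel]])
next
  fix f g :: "config \<Rightarrow>\<^sub>C real" and b
  assume b: "0 \<le> b" and f: "depends_on {-b..b} (apply_bcontfun f)"
    and g: "apply_bcontfun g = exclusion_generator p (apply_bcontfun f)"
  obtain n :: nat where n: "A \<subseteq> {-int n..int n}"
    by (rule finite_int_set_subset_interval[OF A])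
  \<comment> \<open>a range of bonds that meets the support of \<open>f\<close> and all blocks of sites in \<open>A\<close>\<close>
  define m where "m = b + int n + int K"
  have sub: "x + int i \<in> {-m-1..m}" if "x \<in> A" "1 \<le> i" "i < K" for x i
    using n that b unfolding m_def by force
  have m: "b \<le> m" "0 \<le> m" using b by (auto simp: m_def)
  have f': "depends_on {-m..m} (apply_bcontfun f)"
    by (rule depends_on_mono[OF f]) (use m in auto)
  show "2 * bcontfun_inner (bernoulli_measure \<alpha>) (Bcontfun (block_gradient \<alpha> h A K)) f
    \<le> K * (\<Sum>x\<in>A. (h x)\<^sup>2) - bcontfun_inner (bernoulli_measure \<alpha>) f g"
    using block_gradient_dirichlet_bound[OF \<alpha> K A _ sub bcontfun_config_measurable apply_bcontfun_abs_le, of h f]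
      bernoulli_dirichlet_form[OF p bcontfun_config_measurable apply_bcontfun_abs_le f' m(2), of \<alpha>]
    by (simp add: bcontfun_inner_def Bcontfun_inverse[OF block_gradient_bcontfun] g)
qed

text \<open>
  The products \<open>c\<^sub>x c\<^bsub>x+j\<^esub>\<close> for different pairs \<open>(x, j)\<close> are orthogonal, because among the four sites of two
  different pairs one occurs only once.
\<close>

lemma block_average_second_moment:
  assumes \<alpha>: "0 \<le> \<alpha>" "\<alpha> \<le> 1" and K: "0 < K" and A: "finite A"
  shows "(\<integral>\<eta>. (block_average \<alpha> h A K \<eta>)\<^sup>2 \<partial>bernoulli_measure \<alpha>) \<le> (\<Sum>x\<in>A. (h x)\<^sup>2) / K"
proof -
  let ?c = "centered \<alpha>" and ?\<nu> = "bernoulli_measure \<alpha>"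
  let ?\<psi> = "\<lambda>(x, j) \<eta>. ?c \<eta> x * ?c \<eta> (x + int j)"
  have c_le: "\<bar>?c \<eta> x\<bar> \<le> 1" for \<eta> x by (rule centered_abs_le[OF \<alpha>])
  have cc_le: "\<bar>?c \<eta> x * ?c \<eta> y\<bar> \<le> 1" for \<eta> x y
    using abs_mult_le[OF c_le c_le] by simp
  have ccc_le: "\<bar>?c \<eta> x * (?c \<eta> y * ?c \<eta> z)\<bar> \<le> 1" for \<eta> x y z
    using abs_mult_le[OF c_le cc_le] by simp
  have single: "(\<integral>\<eta>. ?c \<eta> x * (?c \<eta> u * (?c \<eta> v * ?c \<eta> w)) \<partial>?\<nu>) = 0"
    if "u \<noteq> x" "v \<noteq> x" "w \<noteq> x" for x u v w
    using that by (intro bernoulli_integral_centered_mult[where C = 1] ccc_le \<alpha>) (auto simp: centered_def)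
  have "block_average \<alpha> h A K \<eta> = (\<Sum>i\<in>A \<times> {1..K}. (h (fst i) / K) * ?\<psi> i \<eta>)" for \<eta>
    unfolding block_average_def
    by (subst sum.cartesian_product')
       (auto intro!: sum.cong simp: sum_distrib_left sum_divide_distrib mult_ac)
  then have "(\<integral>\<eta>. (block_average \<alpha> h A K \<eta>)\<^sup>2 \<partial>?\<nu>) = (\<integral>\<eta>. (\<Sum>i\<in>A \<times> {1..K}. (h (fst i) / K) * ?\<psi> i \<eta>)\<^sup>2 \<partial>?\<nu>)"
    by simp
  also have "\<dots> \<le> (\<Sum>i\<in>A \<times> {1..K}. (h (fst i) / K)\<^sup>2)"
  proof (rule bernoulli_integral_sum_square_le)
    fix i i' assume i: "i \<in> A \<times> {1..K}" "i' \<in> A \<times> {1..K}" and ne: "i \<noteq> i'"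
    obtain x j where xj: "i = (x, j)" by fastforce
    obtain x' j' where xj': "i' = (x', j')" by fastforce
    consider "x < x'" | "x' < x" | "x = x'" "j \<noteq> j'" using ne xj xj' by fastforce
    then show "(\<integral>\<eta>. ?\<psi> i \<eta> * ?\<psi> i' \<eta> \<partial>?\<nu>) = 0"
    proof cases
      case 1
      then show ?thesis using single[of "x + int j" x "x'" "x' + int j'"] i xj xj' by (simp add: mult_ac)
    next
      case 2
      then show ?thesis using single[of "x' + int j'" x' x "x + int j"] i xj xj' by (simp add: mult_ac)
    next
      case 3
      then show ?thesis using single[of x "x + int j" x "x + int j'"] i xj xj' by (simp add: mult_ac)
    qed
  qed (use A cc_le in auto)
  also have "\<dots> = (\<Sum>x\<in>A. (h x)\<^sup>2) / K"
    using K by (subst sum.cartesian_product')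
      (simp add: power_divide power2_eq_square sum_divide_distrib sum_distrib_left)
  finally show ?thesis .
qed

section \<open>The quadratic field\<close>

lemma quadratic_field_eq_gradient_plus_average:
  "(\<Sum>x\<in>A. h x * centered \<alpha> \<eta> x * centered \<alpha> \<eta> (x + 1)) = block_gradient \<alpha> h A K \<eta> + block_average \<alpha> h A K \<eta>"
  by (simp add: block_gradient_def block_average_def sum.distrib[symmetric] algebra_simps)

lemma quadratic_field_bcontfun:
  "(\<lambda>\<eta>. \<Sum>x\<in>A. h x * centered \<alpha> \<eta> x * centered \<alpha> \<eta> (x + 1)) \<in> bcontfun"
  by (intro bcontfun_sum bcontfun_mult const_bcontfun centered_bcontfun)

lemma finite_quadratic_field_second_moment:
  fixes K :: nat and T :: real and h :: "int \<Rightarrow> real"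
  assumes p: "0 \<le> p" "p \<le> 1" and \<alpha>: "0 \<le> \<alpha>" "\<alpha> \<le> 1"
    and X: "asep_process p (bernoulli_measure \<alpha>) M X"
    and A: "finite A" and K: "0 < K" and T: "0 \<le> T"
  shows "(\<integral>\<omega>. (\<integral>s. apply_bcontfun (Bcontfun (\<lambda>\<eta>. \<Sum>x\<in>A. h x * centered \<alpha> \<eta> x * centered \<alpha> \<eta> (x + 1))) (X s \<omega>)
      \<partial>restrict_space lborel {0..T})\<^sup>2 \<partial>M)
    \<le> (4 * K * T + 2 * T\<^sup>2 / K) * (\<Sum>x\<in>A. (h x)\<^sup>2)"
proof -
  obtain S where S: "asep_semigroup p S" and "stationary_markov_process M X S (bernoulli_measure \<alpha>)"
    by (rule asep_process_stationary_markov[OF p X])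
  interpret stationary_markov_process M X S "bernoulli_measure \<alpha>" by fact
  let ?\<sigma> = "\<Sum>x\<in>A. (h x)\<^sup>2"
  have "(\<integral>\<omega>. (\<integral>s. apply_bcontfun (Bcontfun (\<lambda>\<eta>. \<Sum>x\<in>A. h x * centered \<alpha> \<eta> x * centered \<alpha> \<eta> (x + 1))) (X s \<omega>)
      \<partial>restrict_space lborel {0..T})\<^sup>2 \<partial>M)
    \<le> 2 * (\<integral>\<omega>. (\<integral>s. apply_bcontfun (Bcontfun (block_gradient \<alpha> h A K)) (X s \<omega>) \<partial>restrict_space lborel {0..T})\<^sup>2 \<partial>M)
     + 2 * (\<integral>\<omega>. (\<integral>s. apply_bcontfun (Bcontfun (block_average \<alpha> h A K)) (X s \<omega>) \<partial>restrict_space lborel {0..T})\<^sup>2 \<partial>M)"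
    by (rule time_integral_second_moment_add[OF T])
       (simp add: Bcontfun_inverse quadratic_field_bcontfun block_gradient_bcontfun block_average_bcontfun
         quadratic_field_eq_gradient_plus_average)
  also have "\<dots> \<le> 2 * (2 * (K * ?\<sigma>) * T) + 2 * (T\<^sup>2 * (?\<sigma> / K))"
  proof (intro add_mono mult_left_mono)
    show "(\<integral>\<omega>. (\<integral>s. apply_bcontfun (Bcontfun (block_gradient \<alpha> h A K)) (X s \<omega>) \<partial>restrict_space lborel {0..T})\<^sup>2 \<partial>M)
      \<le> 2 * (K * ?\<sigma>) * T"
      by (rule time_integral_energy_bound[OF T generator_graph_block_gradient_bound[OF p \<alpha> S K A]])
    have "(\<integral>\<omega>. (\<integral>s. apply_bcontfun (Bcontfun (block_average \<alpha> h A K)) (X s \<omega>) \<partial>restrict_space lborel {0..T})\<^sup>2 \<partial>M)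
      \<le> T\<^sup>2 * bcontfun_inner (bernoulli_measure \<alpha>) (Bcontfun (block_average \<alpha> h A K)) (Bcontfun (block_average \<alpha> h A K))"
      by (rule time_integral_static_bound[OF T])
    also have "\<dots> \<le> T\<^sup>2 * (?\<sigma> / K)"
      using block_average_second_moment[OF \<alpha> K A, of h]
      by (intro mult_left_mono) (simp_all add: bcontfun_inner_def Bcontfun_inverse block_average_bcontfun power2_eq_square)
    finally show "(\<integral>\<omega>. (\<integral>s. apply_bcontfun (Bcontfun (block_average \<alpha> h A K)) (X s \<omega>) \<partial>restrict_space lborel {0..T})\<^sup>2 \<partial>M)
      \<le> T\<^sup>2 * (?\<sigma> / K)" .
  qed auto
  also have "\<dots> = (4 * K * T + 2 * T\<^sup>2 / K) * ?\<sigma>" by (simp add: algebra_simps)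
  finally show ?thesis .
qed

lemma symmetric_sum_tendsto_infsum:
  fixes g a :: "int \<Rightarrow> real"
  assumes ga: "\<And>x. \<bar>g x\<bar> \<le> a x" and D: "\<And>n. (\<Sum>x\<in>{-int n..int n}. a x) \<le> D"
  shows "(\<lambda>n. \<Sum>x\<in>{-int n..int n}. g x) \<longlonglongrightarrow> (\<Sum>\<^sub>\<infinity>x\<in>UNIV. g x)"
proof -
  have fin: "(\<Sum>x\<in>F. \<bar>g x\<bar>) \<le> D" if F: "finite F" for F
  proof -
    obtain m where "F \<subseteq> {-int m..int m}" by (rule finite_int_set_subset_interval[OF F])
    then have "(\<Sum>x\<in>F. \<bar>g x\<bar>) \<le> (\<Sum>x\<in>{-int m..int m}. \<bar>g x\<bar>)"
      by (intro sum_mono2) auto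
    also have "\<dots> \<le> D" by (rule order_trans[OF sum_mono[OF ga] D])
    finally show ?thesis .
  qed
  have "(\<lambda>x. \<bar>g x\<bar>) summable_on UNIV"
    by (intro nonneg_bdd_above_summable_on bdd_aboveI[of _ D]) (use fin in auto)
  then have "g summable_on UNIV"
    using abs_summable_summable[of g UNIV] by simp
  then have "(sum g \<longlongrightarrow> (\<Sum>\<^sub>\<infinity>x\<in>UNIV. g x)) (finite_subsets_at_top UNIV)"
    using has_sum_infsum unfolding has_sum_def by blast
  moreover have "filterlim (\<lambda>n. {-int n..int n}) (finite_subsets_at_top UNIV) sequentially"
    unfolding filterlim_finite_subsets_at_top
  proof (intro allI impI)
    fix F :: "int set" assume F: "finite F \<and> F \<subseteq> UNIV"
    then obtain m where m: "F \<subseteq> {-int m..int m}" using finite_int_set_subset_interval by blast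
    show "\<forall>\<^sub>F n in sequentially. finite {-int n..int n} \<and> F \<subseteq> {-int n..int n} \<and> {-int n..int n} \<subseteq> UNIV"
      using eventually_ge_at_top[of m]
    proof eventually_elim
      case (elim n)
      then have "{-int m..int m} \<subseteq> {-int n..int n}" by auto
      then show ?case using m by auto
    qed
  qed
  ultimately show ?thesis by (rule filterlim_compose)
qed

lemma quadratic_field_second_moment:
  fixes K :: nat and T :: real and h :: "int \<Rightarrow> real"
  assumes p: "0 \<le> p" "p \<le> 1" and \<alpha>: "0 \<le> \<alpha>" "\<alpha> \<le> 1"
    and X: "asep_process p (bernoulli_measure \<alpha>) M X"
    and K: "0 < K" and T: "0 \<le> T"
    and h1: "\<And>n. (\<Sum>x\<in>{-int n..int n}. \<bar>h x\<bar>) \<le> D" and h2: "\<And>n. (\<Sum>x\<in>{-int n..int n}. (h x)\<^sup>2) \<le> \<sigma>"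
  shows "(\<integral>\<omega>. (\<integral>s. (\<Sum>\<^sub>\<infinity>x\<in>UNIV. h x * centered \<alpha> (X s \<omega>) x * centered \<alpha> (X s \<omega>) (x + 1))
      \<partial>restrict_space lborel {0..T})\<^sup>2 \<partial>M)
    \<le> (4 * K * T + 2 * T\<^sup>2 / K) * \<sigma>"
proof -
  obtain S where "stationary_markov_process M X S (bernoulli_measure \<alpha>)"
    by (rule asep_process_stationary_markov[OF p X])
  interpret stationary_markov_process M X S "bernoulli_measure \<alpha>" by fact
  define V where "V n = Bcontfun (\<lambda>\<eta>. \<Sum>x\<in>{-int n..int n}. h x * centered \<alpha> \<eta> x * centered \<alpha> \<eta> (x + 1))" for n
  have V: "apply_bcontfun (V n) \<eta> = (\<Sum>x\<in>{-int n..int n}. h x * centered \<alpha> \<eta> x * centered \<alpha> \<eta> (x + 1))" for n \<eta>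
    by (simp add: V_def Bcontfun_inverse quadratic_field_bcontfun)
  have summand: "\<bar>h x * centered \<alpha> \<eta> x * centered \<alpha> \<eta> (x + 1)\<bar> \<le> \<bar>h x\<bar>" for \<eta> x
    using abs_mult_le[OF abs_mult_le[OF order_refl centered_abs_le[OF \<alpha>]] centered_abs_le[OF \<alpha>], of "h x" \<eta> x \<eta> "x + 1"] by simp
  show ?thesis
  proof (rule time_integral_second_moment_limit[OF T, where V = V])
    show "(\<lambda>n. apply_bcontfun (V n) \<eta>) \<longlonglongrightarrow> (\<Sum>\<^sub>\<infinity>x\<in>UNIV. h x * centered \<alpha> \<eta> x * centered \<alpha> \<eta> (x + 1))" for \<eta>
      unfolding V by (rule symmetric_sum_tendsto_infsum[OF summand h1])
    show "\<bar>apply_bcontfun (V n) \<eta>\<bar> \<le> D" for n \<eta>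
      unfolding V by (rule order_trans[OF sum_abs order_trans[OF sum_mono[OF summand] h1]])
    show "(\<integral>\<omega>. (\<integral>s. apply_bcontfun (V n) (X s \<omega>) \<partial>restrict_space lborel {0..T})\<^sup>2 \<partial>M)
        \<le> (4 * K * T + 2 * T\<^sup>2 / K) * \<sigma>" for n
      unfolding V_def using K T h2[of n]
      by (intro order_trans[OF finite_quadratic_field_second_moment[OF p \<alpha> X _ K T] mult_left_mono]) auto
  qed
qed

section \<open>Scaling\<close>

lemma set_integral_time_change:
  fixes \<phi> :: "real \<Rightarrow> real"
  assumes "0 < a"
  shows "set_lebesgue_integral lborel {0..t} (\<lambda>s. \<phi> (s * a)) = (\<integral>s. \<phi> s \<partial>restrict_space lborel {0..t * a}) / a"
proof -
  have "(\<integral>s. \<phi> s \<partial>restrict_space lborel {0..t * a}) = (\<integral>s. indicator {0..t * a} s * \<phi> s \<partial>lborel)"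
    by (simp add: integral_restrict_space)
  also have "\<dots> = a * (\<integral>s. indicator {0..t * a} (0 + a * s) * \<phi> (0 + a * s) \<partial>lborel)"
    using assms by (subst lborel_integral_real_affine[where c = a and t = 0]) auto
  also have "(\<lambda>s. indicator {0..t * a} (0 + a * s) * \<phi> (0 + a * s)) = (\<lambda>s. indicator {0..t} s * \<phi> (s * a))"
    using assms by (auto simp: fun_eq_iff indicator_def mult.commute zero_le_mult_iff)
  finally show ?thesis using assms by (simp add: set_lebesgue_integral_def)
qed

lemma schwartz_decay:
  assumes "schwartz H"
  obtains C where "0 \<le> C" "\<And>y. \<bar>H y\<bar> \<le> C / (1 + y\<^sup>2)"
proof -
  have "bounded (range (\<lambda>x. x ^ 0 * (deriv ^^ 0) H x))" "bounded (range (\<lambda>x. x ^ 2 * (deriv ^^ 0) H x))"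
    using assms unfolding schwartz_def by blast+
  then obtain C0 C2 where C: "\<And>y. \<bar>H y\<bar> \<le> C0" "\<And>y. \<bar>y\<^sup>2 * H y\<bar> \<le> C2"
    unfolding bounded_iff by auto
  show ?thesis
  proof (rule that[of "C0 + C2"])
    show "0 \<le> C0 + C2" using C(1)[of 0] C(2)[of 0] by linarith
    fix y :: real
    have "\<bar>H y\<bar> * (1 + y\<^sup>2) \<le> C0 + C2"
      using C(1)[of y] C(2)[of y] by (simp add: abs_mult algebra_simps)
    then show "\<bar>H y\<bar> \<le> (C0 + C2) / (1 + y\<^sup>2)"
      by (simp add: pos_le_divide_eq add_pos_nonneg)
  qed
qed

text \<open>
  By \<open>2 (L\<^sup>2 + k\<^sup>2) \<ge> (L + k)\<^sup>2\<close> the terms at \<open>k\<close> and \<open>-k\<close> are dominated by a multiple of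
  \<open>1 / (L + k - 1) - 1 / (L + k)\<close>, which telescopes.
\<close>

lemma lattice_sum_decay_le:
  fixes L :: real
  assumes L: "1 \<le> L"
  shows "(\<Sum>x\<in>{-int n..int n}. 1 / (1 + (x / L)\<^sup>2)) \<le> 5 * L"
proof -
  have "(\<Sum>x\<in>{-int n..int n}. 1 / (1 + (x / L)\<^sup>2)) \<le> 1 + 4 * L\<^sup>2 * (1 / L - 1 / (L + n))"
  proof (induction n)
    case (Suc n)
    have split: "{-int (Suc n)..int (Suc n)} = insert (- int (Suc n)) (insert (int (Suc n)) {-int n..int n})" by auto
    let ?k = "real (Suc n)"
    have pos: "0 < L + n" "0 < L + ?k" using L by auto
    have "1 / (1 + (?k / L)\<^sup>2) = L\<^sup>2 / (L\<^sup>2 + ?k\<^sup>2)"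
      using L by (simp add: field_simps power_divide)
    also have "\<dots> \<le> L\<^sup>2 / ((L + n) * (L + ?k) / 2)"
    proof (intro divide_left_mono)
      have "(L + n) * (L + ?k) \<le> (L + ?k) * (L + ?k)" using L by (intro mult_right_mono) auto
      also have "\<dots> \<le> 2 * (L\<^sup>2 + ?k\<^sup>2)"
        using sum_squares_bound[of L ?k] by (simp add: power2_eq_square algebra_simps)
      finally show "(L + n) * (L + ?k) / 2 \<le> L\<^sup>2 + ?k\<^sup>2" by simp
    qed (use L pos in \<open>auto intro!: mult_pos_pos add_pos_nonneg\<close>)
    also have "\<dots> = 2 * L\<^sup>2 * (1 / (L + n) - 1 / (L + ?k))"
      using pos by (simp add: field_simps)
    finally have k: "1 / (1 + (?k / L)\<^sup>2) \<le> 2 * L\<^sup>2 * (1 / (L + n) - 1 / (L + ?k))" .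
    have "(\<Sum>x\<in>{-int (Suc n)..int (Suc n)}. 1 / (1 + (x / L)\<^sup>2))
        = 2 * (1 / (1 + (?k / L)\<^sup>2)) + (\<Sum>x\<in>{-int n..int n}. 1 / (1 + (x / L)\<^sup>2))"
      unfolding split by (simp del: of_nat_Suc)
    then show ?case using k Suc by (simp add: algebra_simps)
  qed simp
  also have "\<dots> \<le> 1 + 4 * L\<^sup>2 * (1 / L)"
    using L by (intro add_left_mono mult_left_mono) auto
  also have "\<dots> \<le> 5 * L" using L by (simp add: power2_eq_square)
  finally show ?thesis .
qed

text \<open>
  The block length \<open>K\<close> is \<open>N\<^bsup>(1+\<gamma>)/2\<^esup>\<close> rounded up, the choice that makes the fluctuation of the gradient
  part and the static variance of the averaged part equal in order.
\<close>

lemma scaled_quadratic_field_bound: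
  fixes \<gamma> t C :: real and N :: nat
  assumes p: "0 \<le> p" "p \<le> 1" and \<alpha>: "0 \<le> \<alpha>" "\<alpha> \<le> 1"
    and X: "asep_process p (bernoulli_measure \<alpha>) M X"
    and t: "0 < t" and N: "1 \<le> N" and \<gamma>: "0 < \<gamma>" and C: "0 \<le> C" and H: "\<And>y. \<bar>H y\<bar> \<le> C / (1 + y\<^sup>2)"
  shows "(\<integral>\<omega>. (set_lebesgue_integral lborel {0..t} (\<lambda>s.
               real N powr \<gamma> / sqrt (real N) *
               (\<Sum>\<^sub>\<infinity>x\<in>UNIV. H (real_of_int x / real N)
                  * centered \<alpha> (speeded_up \<gamma> N X s \<omega>) x
                  * centered \<alpha> (speeded_up \<gamma> N X s \<omega>) (x + 1))))\<^sup>2 \<partial>M)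
    \<le> 5 * C\<^sup>2 * (8 * t + 2 * t\<^sup>2) * real N powr ((3 * \<gamma> - 1) / 2)"
proof -
  define L where "L = real N"
  define a where "a = L powr (1 + \<gamma>)"
  define b where "b = L powr ((1 + \<gamma>) / 2)"
  define K where "K = nat \<lceil>b\<rceil>"
  have L: "1 \<le> L" using N by (simp add: L_def)
  have b: "1 \<le> b" unfolding b_def using L \<gamma> by (intro ge_one_powr_ge_zero) auto
  have a: "a = b * b" "0 < a" using L by (simp_all add: a_def b_def powr_add[symmetric])
  \<comment> \<open>rounding up at most doubles, because \<open>b \<ge> 1\<close>\<close>
  have K: "0 < K" "b \<le> real K" "real K \<le> 2 * b"
    using b unfolding K_def by linarith+
  define h where "h x = H (real_of_int x / L)" for x :: int
  define g where "g x = 1 / (1 + (real_of_int x / L)\<^sup>2)" for x :: int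
  have g: "0 \<le> g x" "g x \<le> 1" for x by (auto simp: g_def add_pos_nonneg divide_le_eq_1)
  have hg: "\<bar>h x\<bar> \<le> C * g x" for x using H[of "x / L"] by (simp add: h_def g_def)
  have sum_g: "(\<Sum>x\<in>{-int n..int n}. g x) \<le> 5 * L" for n
    unfolding g_def by (rule lattice_sum_decay_le[OF L])
  have h1: "(\<Sum>x\<in>{-int n..int n}. \<bar>h x\<bar>) \<le> C * (5 * L)" for n
    by (rule order_trans[OF sum_mono[OF hg]])
       (simp add: sum_distrib_left[symmetric] mult_left_mono[OF sum_g C])
  have h2: "(\<Sum>x\<in>{-int n..int n}. (h x)\<^sup>2) \<le> C\<^sup>2 * (5 * L)" for n
  proof -
    have "(h x)\<^sup>2 \<le> C\<^sup>2 * g x" for x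
    proof -
      have "(h x)\<^sup>2 \<le> (C * g x)\<^sup>2" using power_mono[OF hg, of x 2] by simp
      also have "\<dots> \<le> C\<^sup>2 * g x"
        using g[of x] by (simp add: power_mult_distrib power2_eq_square[of "g x"] mult_left_mono mult_left_le)
      finally show ?thesis .
    qed
    then have "(\<Sum>x\<in>{-int n..int n}. (h x)\<^sup>2) \<le> (\<Sum>x\<in>{-int n..int n}. C\<^sup>2 * g x)" by (rule sum_mono)
    also have "\<dots> \<le> C\<^sup>2 * (5 * L)" using mult_left_mono[OF sum_g, of "C\<^sup>2"] by (simp add: sum_distrib_left)
    finally show ?thesis .
  qed
  define c where "c = L powr \<gamma> / sqrt L"
  let ?V = "\<lambda>s \<omega>. \<Sum>\<^sub>\<infinity>x\<in>UNIV. h x * centered \<alpha> (X s \<omega>) x * centered \<alpha> (X s \<omega>) (x + 1)"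
  have "set_lebesgue_integral lborel {0..t} (\<lambda>s. real N powr \<gamma> / sqrt (real N) *
               (\<Sum>\<^sub>\<infinity>x\<in>UNIV. H (real_of_int x / real N)
                  * centered \<alpha> (speeded_up \<gamma> N X s \<omega>) x
                  * centered \<alpha> (speeded_up \<gamma> N X s \<omega>) (x + 1)))
      = c / a * (\<integral>s. ?V s \<omega> \<partial>restrict_space lborel {0..t * a})" for \<omega>
    using set_integral_time_change[OF a(2), of t "\<lambda>s. ?V s \<omega>"]
    by (simp add: speeded_up_def L_def[symmetric] a_def[symmetric] c_def[symmetric] h_def)
  then have "(\<integral>\<omega>. (set_lebesgue_integral lborel {0..t} (\<lambda>s. real N powr \<gamma> / sqrt (real N) *
               (\<Sum>\<^sub>\<infinity>x\<in>UNIV. H (real_of_int x / real N)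
                  * centered \<alpha> (speeded_up \<gamma> N X s \<omega>) x
                  * centered \<alpha> (speeded_up \<gamma> N X s \<omega>) (x + 1))))\<^sup>2 \<partial>M)
      = (c / a)\<^sup>2 * (\<integral>\<omega>. (\<integral>s. ?V s \<omega> \<partial>restrict_space lborel {0..t * a})\<^sup>2 \<partial>M)"
    by (simp only: power_mult_distrib integral_mult_right_zero)
  also have "\<dots> \<le> (c / a)\<^sup>2 * ((4 * K * (t * a) + 2 * (t * a)\<^sup>2 / K) * (C\<^sup>2 * (5 * L)))"
    using t a by (intro mult_left_mono quadratic_field_second_moment[OF p \<alpha> X K(1) _ h1 h2]) auto
  also have "\<dots> = 5 * C\<^sup>2 * (c\<^sup>2 * L) * (4 * t * K / a + 2 * t\<^sup>2 / K)"
    using less_imp_neq[OF a(2)] K(1) by (simp add: field_simps power2_eq_square)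
  also have "c\<^sup>2 * L = L powr (2 * \<gamma>)"
    using L by (simp add: c_def power_divide powr_add[symmetric] power2_eq_square flip: mult_2)
  also have "5 * C\<^sup>2 * L powr (2 * \<gamma>) * (4 * t * K / a + 2 * t\<^sup>2 / K)
      \<le> 5 * C\<^sup>2 * L powr (2 * \<gamma>) * (8 * t / b + 2 * t\<^sup>2 / b)"
  proof (intro mult_left_mono add_mono)
    show "4 * t * K / a \<le> 8 * t / b"
    proof -
      have "4 * t * K / a \<le> 4 * t * (2 * b) / a"
        using t K(3) a(2) by (intro divide_right_mono mult_left_mono) auto
      then show ?thesis using b by (simp add: a(1))
    qed
    show "2 * t\<^sup>2 / K \<le> 2 * t\<^sup>2 / b"
      using b K by (intro divide_left_mono) auto
  qed (use C in auto)
  also have "\<dots> = 5 * C\<^sup>2 * (8 * t + 2 * t\<^sup>2) * (L powr (2 * \<gamma>) / b)"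
    by (simp add: algebra_simps add_divide_distrib)
  also have "L powr (2 * \<gamma>) / b = L powr ((3 * \<gamma> - 1) / 2)"
    using L by (simp add: b_def powr_diff[symmetric] field_simps)
  finally show ?thesis by (simp add: L_def)
qed

theorem theorem2p6:
  fixes p \<alpha> \<gamma> t :: real
    and M :: "'w measure"
    and \<eta> :: "real \<Rightarrow> 'w \<Rightarrow> config"
    and H :: "real \<Rightarrow> real"
  assumes "0 \<le> p" "p \<le> 1" "p \<noteq> 1 / 2"
    and "0 < \<alpha>" "\<alpha> < 1"
    and "0 < \<gamma>" "\<gamma> < 1 / 3"
    and "asep_process p (bernoulli_measure \<alpha>) M \<eta>"
    and "0 < t"
    and "schwartz H"
  shows "(\<lambda>N. prob_space.expectation M (\<lambda>\<omega>.
            (set_lebesgue_integral lborel {0..t} (\<lambda>s.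
               real N powr \<gamma> / sqrt (real N) *
               (\<Sum>\<^sub>\<infinity>x\<in>UNIV. H (real_of_int x / real N)
                  * centered \<alpha> (speeded_up \<gamma> N \<eta> s \<omega>) x
                  * centered \<alpha> (speeded_up \<gamma> N \<eta> s \<omega>) (x + 1))))\<^sup>2))
         \<longlonglongrightarrow> 0"
proof -
  obtain C where C: "0 \<le> C" "\<And>y. \<bar>H y\<bar> \<le> C / (1 + y\<^sup>2)"
    using schwartz_decay[OF \<open>schwartz H\<close>] by blast
  have "(\<lambda>N. real N powr ((3 * \<gamma> - 1) / 2)) \<longlonglongrightarrow> 0"
    using \<open>\<gamma> < 1 / 3\<close> by (intro tendsto_neg_powr filterlim_real_sequentially) auto
  then have lim: "(\<lambda>N. 5 * C\<^sup>2 * (8 * t + 2 * t\<^sup>2) * real N powr ((3 * \<gamma> - 1) / 2)) \<longlonglongrightarrow> 0"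
    by (rule tendsto_mult_right_zero)
  show ?thesis
  proof (rule tendsto_sandwich[OF _ _ tendsto_const lim])
    show "\<forall>\<^sub>F N in sequentially. prob_space.expectation M (\<lambda>\<omega>.
            (set_lebesgue_integral lborel {0..t} (\<lambda>s.
               real N powr \<gamma> / sqrt (real N) *
               (\<Sum>\<^sub>\<infinity>x\<in>UNIV. H (real_of_int x / real N)
                  * centered \<alpha> (speeded_up \<gamma> N \<eta> s \<omega>) x
                  * centered \<alpha> (speeded_up \<gamma> N \<eta> s \<omega>) (x + 1))))\<^sup>2)
        \<le> 5 * C\<^sup>2 * (8 * t + 2 * t\<^sup>2) * real N powr ((3 * \<gamma> - 1) / 2)"
      using eventually_ge_at_top[of 1]
      by eventually_elim (rule scaled_quadratic_field_bound; use assms C in auto)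
  qed (auto intro: always_eventually)
qed

end
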